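(* Let $K\subseteq\mathbb{R}^2$ be a rectangle with side-lengths $0<a\le b$, and let $Y_{M,N}$ be the random bounce length obtained from $M$ random particles in $K$, each followed for $N$ bounces (as defined in the context). Then, as $M\to\infty$ followed by $N\to\infty$, $Y_{M,N}$ converges in distribution to a random variable $Y$ whose probability density function $\operatorname{pdf}_Y(t)$ is given by $$\frac{2}{\pi}\Bigg(\frac{2(a+b)}{a^2+b^2}-\frac{2ab}{(a^2+b^2)^{3/2}}\left(\tanh^{-1}\left(\frac{a}{\sqrt{a^2+b^2}}\right)+\tanh^{-1}\left(\frac{b}{\sqrt{a^2+b^2}}\right)\right)\Bigg)$$ for $t>0$ with $t<a$ and $t<b$; by $$\begin{aligned}\frac{2}{\pi}\Bigg(&\frac{a\left(b-\sqrt{t^2-a^2}\right)}{t\,(b+\sqrt{t^2-a^2})\sqrt{t^2-a^2}}+\frac{2ab+2at-2a\sqrt{t^2-a^2}}{t(a^2+b^2)}\\&+\frac{2ab\left(-\tanh^{-1}\left(\frac{t}{\sqrt{a^2+b^2}}\right)+\tanh^{-1}\left(\frac{\sqrt{t^2-a^2}\sqrt{a^2+b^2}}{tb}\right)-\tanh^{-1}\left(\frac{b}{\sqrt{a^2+b^2}}\right)\right)}{(a^2+b^2)^{3/2}}\Bigg)\end{aligned}$$ for $a<t<b$; and by $$\begin{aligned}\frac{2}{\pi}\Bigg(&\frac{a(b-\sqrt{t^2-a^2})}{t\,(b+\sqrt{t^2-a^2})\sqrt{t^2-a^2}}+\frac{b(a-\sqrt{t^2-b^2})}{t\,(a+\sqrt{t^2-b^2})\sqrt{t^2-b^2}}+2\,\frac{2ab-a\sqrt{t^2-a^2}-b\sqrt{t^2-b^2}}{t(a^2+b^2)}\\&+\frac{2ab\left(-2\tanh^{-1}\left(\frac{t}{\sqrt{a^2+b^2}}\right)+\tanh^{-1}\left(\frac{\sqrt{t^2-a^2}\sqrt{a^2+b^2}}{tb}\right)+\tanh^{-1}\left(\frac{\sqrt{t^2-b^2}\sqrt{a^2+b^2}}{ta}\right)\right)}{(a^2+b^2)^{3/2}}\Bigg)\end{aligned}$$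 for $t>a$ and $t>b$ with $t<\sqrt{a^2+b^2}$.
   Context: $K=[0,a]\times[0,b]$, and $\mu$ is a given probability measure on $K$. Definition of $Y_{M,N}$ (for positive integers $M,N$): choose initial positions $p^{(1)},\dots,p^{(M)}\in K$ i.i.d. with law $\mu$, and directions $v^{(1)},\dots,v^{(M)}\in\mathbb{S}^1$ i.i.d. uniformly distributed on the unit circle. The $i$-th particle starts at $p^{(i)}$ in direction $v^{(i)}$ and travels along straight lines inside $K$, changing direction precisely when it hits the boundary of $K$, where it reflects specularly; it is followed for $N$ bounces (the same number $N$ for every particle). Record the distances travelled between consecutive bounces of each particle, and form the multiset of all these bounce lengths of all $M$ particles (multiplicities added). $Y_{M,N}$ is an element of this finite multiset chosen uniformly at random, counted with multiplicity. "As $M\to\infty$ followed by $N\to\infty$" means the iterated limit in which first $M\to\infty$ with $N$ fixed and then $N\to\infty$. Here $\tanh^{-1}(z)=\frac12\log\frac{1+z}{1-z}$ for $|z|<1$. *)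

theory Defs
  imports "HOL-Probability.Probability"
begin

definition rectangle :: "real \<Rightarrow> real \<Rightarrow> (real \<times> real) set" where
  "rectangle a b = {0..a} \<times> {0..b}"

text \<open>
  A particle is a pair of a position in the rectangle and a unit direction. Since the
  rectangle is convex and compact, the times at which the straight trajectory is inside it
  form a compact interval starting at 0, and the supremum is its right end point.
\<close>

definition flight_time :: "real \<Rightarrow> real \<Rightarrow> (real \<times> real) \<times> (real \<times> real) \<Rightarrow> real" where
  "flight_time a b = (\<lambda>(p, v). Sup {t. 0 \<le> t \<and> p + t *\<^sub>R v \<in> rectangle a b})"

text \<open>
  Specular reflection at the walls which the direction points out of. At a corner that is
  hit exactly, both components are reversed and this counts as a single bounce.
\<close>

definition reflect :: "real \<Rightarrow> real \<Rightarrow> real \<times> real \<Rightarrow> real \<times> real \<Rightarrow> real \<times> real" where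
  "reflect a b = (\<lambda>(x, y) (v, w).
     (if x = 0 \<and> v < 0 \<or> x = a \<and> v > 0 then - v else v,
      if y = 0 \<and> w < 0 \<or> y = b \<and> w > 0 then - w else w))"

text \<open>
  A particle that starts on a wall and points out of the rectangle has its first bounce at
  time 0.
\<close>

definition bounce ::
    "real \<Rightarrow> real \<Rightarrow> (real \<times> real) \<times> (real \<times> real) \<Rightarrow> (real \<times> real) \<times> (real \<times> real)" where
  "bounce a b = (\<lambda>(p, v).
     let q = p + flight_time a b (p, v) *\<^sub>R v in (q, reflect a b q v))"

text \<open>For \<open>k \<ge> 1\<close> this is the position of the \<open>k\<close>-th bounce, for \<open>k = 0\<close> the initial position.\<close>

definition bounce_point ::
    "real \<Rightarrow> real \<Rightarrow> (real \<times> real) \<times> (real \<times> real) \<Rightarrow> nat \<Rightarrow> real \<times> real" where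
  "bounce_point a b s k = fst ((bounce a b ^^ k) s)"

text \<open>
  \<open>N\<close> bounces have \<open>N - 1\<close> distances between consecutive ones; the segment from the initial
  position to the first bounce is not recorded.
\<close>

definition bounce_lengths ::
    "real \<Rightarrow> real \<Rightarrow> nat \<Rightarrow> (real \<times> real) \<times> (real \<times> real) \<Rightarrow> real multiset" where
  "bounce_lengths a b N s =
     {#dist (bounce_point a b s k) (bounce_point a b s (k + 1)). k \<in># mset_set {1..<N}#}"

definition all_bounce_lengths ::
    "real \<Rightarrow> real \<Rightarrow> nat \<Rightarrow> nat \<Rightarrow> (nat \<Rightarrow> (real \<times> real) \<times> (real \<times> real)) \<Rightarrow> real multiset" where
  "all_bounce_lengths a b M N \<omega> = (\<Sum>i<M. bounce_lengths a b N (\<omega> i))"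

definition uniform_circle :: "(real \<times> real) measure" where
  "uniform_circle =
     distr (uniform_measure lborel {0..<2 * pi}) (restrict_space borel (sphere 0 1))
       (\<lambda>\<theta>. (cos \<theta>, sin \<theta>))"

definition particles_law ::
    "(real \<times> real) measure \<Rightarrow> nat \<Rightarrow> (nat \<Rightarrow> (real \<times> real) \<times> (real \<times> real)) measure" where
  "particles_law \<mu> M = PiM {..<M} (\<lambda>_. \<mu> \<Otimes>\<^sub>M uniform_circle)"

text \<open>
  The distribution of \<open>Y\<^sub>M\<^sub>,\<^sub>N\<close>: sample the particles, then sample from the multiset of their bounce
  lengths. It is meaningful for \<open>M \<ge> 1\<close> and \<open>N \<ge> 2\<close>, when that multiset is nonempty. The
  inner \<open>distr\<close> only replaces the discrete sigma-algebra by the Borel one.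
\<close>

definition bounce_length_law ::
    "real \<Rightarrow> real \<Rightarrow> (real \<times> real) measure \<Rightarrow> nat \<Rightarrow> nat \<Rightarrow> real measure" where
  "bounce_length_law a b \<mu> M N =
     Giry_Monad.bind (particles_law \<mu> M)
       (\<lambda>\<omega>. distr (measure_pmf (pmf_of_multiset (all_bounce_lengths a b M N \<omega>))) borel (\<lambda>x. x))"

definition bounce_pdf :: "real \<Rightarrow> real \<Rightarrow> real \<Rightarrow> real" where
  "bounce_pdf a b t =
    (if 0 < t \<and> t < a \<and> t < b then
       2 / pi *
         (2 * (a + b) / (a\<^sup>2 + b\<^sup>2)
          - 2 * a * b / (a\<^sup>2 + b\<^sup>2) powr (3/2)
            * (artanh (a / sqrt (a\<^sup>2 + b\<^sup>2)) + artanh (b / sqrt (a\<^sup>2 + b\<^sup>2))))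
     else if a < t \<and> t < b then
       2 / pi *
         (a * (b - sqrt (t\<^sup>2 - a\<^sup>2)) / (t * (b + sqrt (t\<^sup>2 - a\<^sup>2)) * sqrt (t\<^sup>2 - a\<^sup>2))
          + (2 * a * b + 2 * a * t - 2 * a * sqrt (t\<^sup>2 - a\<^sup>2)) / (t * (a\<^sup>2 + b\<^sup>2))
          + 2 * a * b
            * (- artanh (t / sqrt (a\<^sup>2 + b\<^sup>2))
               + artanh (sqrt (t\<^sup>2 - a\<^sup>2) * sqrt (a\<^sup>2 + b\<^sup>2) / (t * b))
               - artanh (b / sqrt (a\<^sup>2 + b\<^sup>2)))
            / (a\<^sup>2 + b\<^sup>2) powr (3/2))
     else if a < t \<and> b < t \<and> t < sqrt (a\<^sup>2 + b\<^sup>2) then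
       2 / pi *
         (a * (b - sqrt (t\<^sup>2 - a\<^sup>2)) / (t * (b + sqrt (t\<^sup>2 - a\<^sup>2)) * sqrt (t\<^sup>2 - a\<^sup>2))
          + b * (a - sqrt (t\<^sup>2 - b\<^sup>2)) / (t * (a + sqrt (t\<^sup>2 - b\<^sup>2)) * sqrt (t\<^sup>2 - b\<^sup>2))
          + 2 * ((2 * a * b - a * sqrt (t\<^sup>2 - a\<^sup>2) - b * sqrt (t\<^sup>2 - b\<^sup>2)) / (t * (a\<^sup>2 + b\<^sup>2)))
          + 2 * a * b
            * (- 2 * artanh (t / sqrt (a\<^sup>2 + b\<^sup>2))
               + artanh (sqrt (t\<^sup>2 - a\<^sup>2) * sqrt (a\<^sup>2 + b\<^sup>2) / (t * b))
               + artanh (sqrt (t\<^sup>2 - b\<^sup>2) * sqrt (a\<^sup>2 + b\<^sup>2) / (t * a)))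
            / (a\<^sup>2 + b\<^sup>2) powr (3/2))
     else 0)"

end

theory Submission
  imports Defs
begin

text \<open>
  Four observations carry the proof.

  First, the particles are independent and identically distributed and each contributes the same
  number of bounce lengths, so picking a bounce length at random has the same law for every
  number of particles: it is the expected empirical measure of the bounce lengths of a single
  particle (\<open>emeasure_bounce_length_law\<close>). The limit in the number of particles is therefore the
  limit of a constant sequence.

  Second, a reflection only flips signs of velocity components, so for a direction \<open>(v, w)\<close> with
  \<open>v, w \<noteq> 0\<close> the particle meets vertical walls with period \<open>\<alpha> = a / \<bar>v\<bar>\<close> and horizontal walls
  with period \<open>\<beta> = b / \<bar>w\<bar>\<close>, independently of each other. The bounce lengths are the gaps between
  successive ticks of two periodic clocks (\<open>dist_bounce_point_eq_clock_gap\<close>). If \<open>\<alpha> < \<beta>\<close>, then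
  every tick of the slow clock cuts one period \<open>\<alpha>\<close> of the fast clock in two, and all other gaps
  equal \<open>\<alpha>\<close>. When \<open>\<beta> / \<alpha>\<close> is irrational, the cutting points are equidistributed in the period.
  Per unit of time there are \<open>2 / \<beta>\<close> gaps which are uniform on \<open>[0, \<alpha>]\<close> and
  \<open>1 / \<alpha> - 1 / \<beta>\<close> gaps equal to \<open>\<alpha>\<close>, among \<open>1 / \<alpha> + 1 / \<beta>\<close> gaps in total. Hence the asymptotic
  proportion of gaps of length at most \<open>x\<close> is \<open>2 * x / (\<alpha> + \<beta>)\<close> for \<open>0 \<le> x < min \<alpha> \<beta>\<close> and jumps to 1
  at \<open>min \<alpha> \<beta>\<close> (\<open>two_clocks_gap_frequency\<close>).

  Third, all but countably many directions have irrational \<open>\<beta> / \<alpha>\<close>, and the limit does not depend on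
  the initial position. By dominated convergence the distribution functions converge pointwise to
  the average of this proportion over the uniform direction (\<open>cdf_tendsto\<close>).

  Fourth, this average is elementary. On the quadrant \<open>0 \<le> \<theta> \<le> \<pi> / 2\<close> the integrand is 1 for
  \<open>\<theta>\<close> below some angle and above another one, and it is
  \<open>2 * x / (a / cos \<theta> + b / sin \<theta>)\<close> in between, where \<open>angle_integral\<close> is an
  antiderivative of the factor of \<open>x\<close>. Differentiating the resulting function of \<open>x\<close> gives the
  stated density away from \<open>0\<close>, \<open>a\<close>, \<open>b\<close> and the diagonal; the addition theorem of \<open>artanh\<close>
  brings it into the stated form (\<open>bounce_pdf_eq\<close>), and the fundamental theorem of calculus
  recovers the distribution function from it (\<open>has_integral_bounce_pdf\<close>).
\<close>

section \<open>Equidistribution of irrational rotations\<close>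

text \<open>
  The number of visits to the half-open arc of length \<open>l\<close> starting at \<open>c\<close> on the circle of
  length 1.
\<close>
definition arc_hits :: "(nat \<Rightarrow> real) \<Rightarrow> real \<Rightarrow> real \<Rightarrow> nat \<Rightarrow> nat" where
  "arc_hits x c l n = card {k. k < n \<and> frac (x k - c) < l}"

lemma frac_eqI: "x - r = of_int m \<Longrightarrow> 0 \<le> r \<Longrightarrow> r < 1 \<Longrightarrow> frac x = (r::real)"
  by (subst frac_unique_iff) auto

text \<open>
  The \<open>L\<close> arcs of length \<open>1 / L\<close> starting at the multiples of \<open>1 / L\<close> are disjoint on the circle,
  because a point determines the index of the arc that contains it.
\<close>
lemma short_arc_index:
  fixes z :: real and i L :: nat
  assumes "i < L" "frac (z - i / L) < 1 / L"
  shows "int i = \<lfloor>real L * z\<rfloor> mod int L"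
proof -
  define s where "s = \<lfloor>z - i / L\<rfloor>"
  have L: "0 < real L" using assms by simp
  have "0 \<le> z - i / L - s" "z - i / L - s < 1 / L"
    using assms frac_ge_0[of "z - i/L"] by (auto simp: frac_def s_def)
  then have "0 \<le> L * (z - i / L - s)" "L * (z - i / L - s) < L * (1 / L)"
    using L by (auto intro: mult_strict_left_mono simp del: times_divide_eq_right)
  then have "\<lfloor>real L * z\<rfloor> = int i + int L * s"
    using L by (intro floor_unique) (auto simp: algebra_simps)
  then show ?thesis using assms by simp
qed

text \<open>
  An arc shorter than \<open>1 / L\<close> receives asymptotically at most the share \<open>1 / L\<close> of the orbit. Since
  the orbit of an irrational rotation is dense, iterates of the rotation carry the arc into each
  of the \<open>L\<close> disjoint arcs of length \<open>1 / L\<close>. Each of these \<open>L\<close> copies is hit as often as the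
  original arc up to a delay of bounded length, and together they are hit at most once at a time.
\<close>
lemma short_arc_hits_le:
  fixes \<rho> \<delta> c l :: real and L :: nat
  assumes "\<rho> \<notin> \<rat>" "0 < L" "0 \<le> l" "l < 1 / L"
  shows "\<exists>C::nat. \<forall>n. L * arc_hits (\<lambda>k. \<delta> + k * \<rho>) c l n \<le> n + C"
proof -
  let ?x = "\<lambda>k::nat. \<delta> + k * \<rho>"
  \<comment> \<open>the room for shifting the short arc inside an arc of length \<open>1 / L\<close>\<close>
  define e where "e = 1 / L - l"
  have e: "0 < e" "l + e = 1 / L" "1 / L \<le> 1" using assms by (auto simp: e_def)
  have "\<exists>m::nat. frac (c + m * \<rho> - i / L) < e" for i :: nat
  proof -
    obtain h k where k: "k > 0" "\<bar>of_int k * \<rho> - of_int h - (i / L - c + e / 2)\<bar> < e / 2"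
      using sequence_of_fractional_parts_is_dense[of \<rho> "e/2" "i / L - c + e / 2"] assms(1) e(1)
      by (metis half_gt_zero)
    have eq: "real (nat k) = of_int k" using k by simp
    have "frac (c + real (nat k) * \<rho> - i / L) = of_int k * \<rho> - of_int h - (i / L - c)"
      using k e assms unfolding eq by (intro frac_eqI[of _ _ h]) (simp, linarith, linarith)
    also have "\<dots> < e" using k by linarith
    finally show ?thesis by blast
  qed
  then obtain m :: "nat \<Rightarrow> nat" where m: "\<And>i. frac (c + m i * \<rho> - i / L) < e" by metis
  define C where "C = (\<Sum>i<L. m i)"
  have mC: "m i \<le> C" if "i < L" for i
    unfolding C_def using that by (intro member_le_sum) auto
  have "L * arc_hits ?x c l n \<le> n + C" for n
  proof -
    define A where "A = {k. k < n \<and> frac (?x k - c) < l}"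
    define B where "B i = (\<lambda>k. k + m i) ` A" for i
    have finA: "finite A" by (auto simp: A_def)
    have B: "frac (?x k - i / L) < 1 / L" if k: "k \<in> B i" for i k
    proof -
      obtain j where j: "k = j + m i" "frac (?x j - c) < l" using k by (auto simp: B_def A_def)
      have "frac (?x k - i / L) = frac ((?x j - c) + (c + m i * \<rho> - i / L))"
        by (simp add: j algebra_simps)
      also have "\<dots> < l + e"
        using j m[of i] e unfolding frac_add by auto
      finally show ?thesis using e by simp
    qed
    have disj: "B i \<inter> B j = {}" if "i < L" "j < L" "i \<noteq> j" for i j
      using that B[of _ i] B[of _ j] short_arc_index by (metis disjoint_iff nat_int)
    have "L * arc_hits ?x c l n = (\<Sum>i<L. card (B i))"
      by (simp add: arc_hits_def A_def[symmetric] B_def card_image)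
    also have "\<dots> = card (\<Union>i<L. B i)"
      using disj finA by (subst card_UN_disjoint) (auto simp: B_def)
    also have "\<dots> \<le> card {..<n + C}"
      using mC by (intro card_mono) (force simp: B_def A_def)+
    finally show ?thesis by simp
  qed
  then show ?thesis by blast
qed

text \<open>
  An arc of length \<open>y\<close> is covered by about \<open>y * (L + 1)\<close> arcs of length \<open>1 / (L + 1)\<close>, which is just
  below \<open>1 / L\<close>. The bound for short arcs then gives a share of at most \<open>(y * (L + 1) + 1) / L\<close>.
\<close>
lemma arc_hits_upper:
  fixes \<rho> \<delta> c y :: real
  assumes "\<rho> \<notin> \<rat>" "0 \<le> y" "y \<le> 1" "0 < e"
  shows "\<forall>\<^sub>F n in sequentially. arc_hits (\<lambda>k. \<delta> + k * \<rho>) c y n \<le> (y + e) * n"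
proof -
  let ?x = "\<lambda>k::nat. \<delta> + k * \<rho>"
  \<comment> \<open>the share \<open>(y * (L + 1) + 1) / L\<close> is at most \<open>y + 2 / L\<close>, so half of \<open>e\<close> is left to absorb the delays\<close>
  obtain L :: nat where L: "4 / e < L" using reals_Archimedean2 by blast
  with \<open>0 < e\<close> have Lpos: "0 < L" by (metis divide_pos_pos gr0I less_numeral_extra(3) of_nat_0 order_less_trans zero_less_numeral)
  define l where "l = 1 / (real L + 1)"
  define r where "r = nat \<lceil>y * (real L + 1)\<rceil>"
  have l: "0 < l" "l < 1 / L" "l < 1" using Lpos by (auto simp: l_def field_simps)
  have "\<forall>i::nat. \<exists>C::nat. \<forall>n. L * arc_hits ?x (c + i * l) l n \<le> n + C"
    using short_arc_hits_le[OF assms(1) Lpos] l by auto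
  then obtain C :: "nat \<Rightarrow> nat" where C: "\<And>i n. L * arc_hits ?x (c + i * l) l n \<le> n + C i"
    by metis
  define D where "D = (\<Sum>i<r. C i)"
  have rle: "real r \<le> L * (y + e / 2)"
  proof -
    have "0 \<le> y * (real L + 1)" using assms by simp
    then have "real r \<le> y * (real L + 1) + 1" unfolding r_def by linarith
    also have "\<dots> \<le> L * y + 2" using assms by (simp add: algebra_simps)
    also have "2 \<le> L * (e / 2)" using L \<open>0 < e\<close> by (simp add: field_simps)
    finally show ?thesis by (simp add: algebra_simps)
  qed
  have *: "real (arc_hits ?x c y n) \<le> (y + e / 2) * n + D" for n
  proof -
    have sub: "{k. k < n \<and> frac (?x k - c) < y} \<subseteq> (\<Union>i<r. {k. k < n \<and> frac (?x k - (c + i * l)) < l})"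
    proof (clarify)
      fix k assume k: "k < n" "frac (?x k - c) < y"
      define f where "f = frac (?x k - c)"
      define i where "i = nat \<lfloor>f / l\<rfloor>"
      have f: "0 \<le> f" "f < y" using k by (auto simp: f_def)
      then have i: "real i \<le> f / l" "f / l < real i + 1" unfolding i_def using l by auto
      have "f / l < y * (real L + 1)" using f by (auto simp: l_def mult_strict_right_mono)
      then have "i < r" unfolding r_def using i(1) by linarith
      have "i * l \<le> f" "f < i * l + l" using i l by (simp_all add: field_simps)
      then have "frac (?x k - (c + i * l)) = f - i * l"
        using l by (intro frac_eqI[of _ _ "\<lfloor>?x k - c\<rfloor>"]) (auto simp: f_def frac_def)
      then have "frac (?x k - (c + i * l)) < l" using \<open>f < i * l + l\<close> by linarith
      then show "k \<in> (\<Union>i<r. {k. k < n \<and> frac (?x k - (c + i * l)) < l})"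
        using \<open>i < r\<close> k by blast
    qed
    have "arc_hits ?x c y n \<le> card (\<Union>i<r. {k. k < n \<and> frac (?x k - (c + i * l)) < l})"
      unfolding arc_hits_def using sub by (intro card_mono) auto
    also have "\<dots> \<le> (\<Sum>i<r. arc_hits ?x (c + i * l) l n)"
      unfolding arc_hits_def by (intro card_UN_le) auto
    finally have "L * arc_hits ?x c y n \<le> (\<Sum>i<r. L * arc_hits ?x (c + i * l) l n)"
      by (simp add: sum_distrib_left[symmetric])
    also have "\<dots> \<le> (\<Sum>i<r. n + C i)" by (intro sum_mono C)
    also have "\<dots> = r * n + D" by (simp add: sum.distrib D_def)
    finally have "real (L * arc_hits ?x c y n) \<le> real (r * n + D)" by (rule of_nat_mono)
    then have "L * real (arc_hits ?x c y n) \<le> r * real n + D" by simp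
    also have "\<dots> \<le> L * (y + e / 2) * n + L * D"
      using Lpos rle by (intro add_mono mult_right_mono) (auto simp: mult_le_cancel_right1)
    also have "\<dots> = L * ((y + e / 2) * n + D)" by (simp add: algebra_simps)
    finally show ?thesis using Lpos by (simp add: mult_le_cancel_left_pos)
  qed
  have "\<forall>\<^sub>F n in sequentially. D / (e/2) \<le> real n"
    using filterlim_real_sequentially by (simp add: filterlim_at_top)
  then show ?thesis
  proof eventually_elim
    case (elim n)
    then have "D \<le> e / 2 * n" using \<open>0 < e\<close> by (simp add: field_simps)
    then show ?case using *[of n] by (simp add: algebra_simps)
  qed
qed

text \<open>The complement of an arc is an arc, which turns upper bounds for all arcs into lower bounds.\<close>
lemma arc_hits_complement:
  assumes "0 \<le> y" "y \<le> 1"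
  shows "arc_hits x c y n + arc_hits x (c + y) (1 - y) n = n"
proof -
  have *: "frac (x k - c) < y \<longleftrightarrow> \<not> frac (x k - (c + y)) < 1 - y" for k
  proof -
    define f where "f = frac (x k - c)"
    have f: "0 \<le> f" "f < 1" by (auto simp: f_def frac_lt_1)
    have "x k - c = f + \<lfloor>x k - c\<rfloor>" by (simp add: f_def frac_def)
    then have "frac (x k - (c + y)) = (if f < y then f - y + 1 else f - y)"
      using f assms
      by (intro frac_eqI[of _ _ "if f < y then \<lfloor>x k - c\<rfloor> - 1 else \<lfloor>x k - c\<rfloor>"]) (auto split: if_splits)
    then show ?thesis using f by (auto simp: f_def[symmetric])
  qed
  have "arc_hits x c y n + arc_hits x (c + y) (1 - y) n =
    card ({k. k < n \<and> frac (x k - c) < y} \<union> {k. k < n \<and> frac (x k - (c + y)) < 1 - y})"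
    unfolding arc_hits_def using * by (intro card_Un_disjoint[symmetric]) auto
  also have "{k. k < n \<and> frac (x k - c) < y} \<union> {k. k < n \<and> frac (x k - (c + y)) < 1 - y} = {..<n}"
    using * by auto
  finally show ?thesis by simp
qed

text \<open>
  Weyl's equidistribution theorem for arcs, obtained from the density of the orbit by counting
  alone, without exponential sums.
\<close>
lemma irrational_rotation_equidistributed:
  fixes \<rho> \<delta> c y :: real
  assumes "\<rho> \<notin> \<rat>" "0 \<le> y" "y \<le> 1"
  shows "(\<lambda>n. arc_hits (\<lambda>k. \<delta> + k * \<rho>) c y n / n) \<longlonglongrightarrow> y"
proof (rule LIMSEQ_I)
  let ?x = "\<lambda>k::nat. \<delta> + k * \<rho>"
  fix e :: real assume e: "0 < e"
  have "\<forall>\<^sub>F n in sequentially. arc_hits ?x c y n \<le> (y + e/2) * n \<and>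
      arc_hits ?x (c + y) (1 - y) n \<le> (1 - y + e/2) * n \<and> n > 0"
    using assms e by (intro eventually_conj arc_hits_upper eventually_gt_at_top) auto
  then have "\<forall>\<^sub>F n in sequentially. norm (arc_hits ?x c y n / n - y) < e"
  proof eventually_elim
    case (elim n)
    have "real (arc_hits ?x c y n) + real (arc_hits ?x (c + y) (1 - y) n) = n"
      using arc_hits_complement[OF assms(2,3), of ?x c n] by linarith
    then have "(y - e / 2) * n \<le> arc_hits ?x c y n" using elim by (simp add: algebra_simps)
    then have "y - e/2 \<le> arc_hits ?x c y n / n" "arc_hits ?x c y n / n \<le> y + e/2"
      using elim by (auto simp: field_simps)
    then show ?case using e by (auto simp: abs_if)
  qed
  then show "\<exists>no. \<forall>n\<ge>no. norm (arc_hits ?x c y n / n - y) < e"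
    by (simp add: eventually_sequentially)
qed

section \<open>Two periodic clocks\<close>

text \<open>
  The state of the two clocks consists of the times until their next ticks. A step advances the
  time to the earlier of the two ticks; if they coincide, both clocks are reset.
\<close>
definition clock_step :: "real \<Rightarrow> real \<Rightarrow> real \<times> real \<Rightarrow> real \<times> real" where
  "clock_step \<alpha> \<beta> = (\<lambda>(p, q). (if p \<le> q then \<alpha> else p - q, if q \<le> p then \<beta> else q - p))"

definition clock_gap :: "real \<Rightarrow> real \<Rightarrow> real \<times> real \<Rightarrow> nat \<Rightarrow> real" where
  "clock_gap \<alpha> \<beta> s k = (case (clock_step \<alpha> \<beta> ^^ k) s of (p, q) \<Rightarrow> min p q)"

text \<open>
  The distribution function of a mixture: uniform on \<open>[0, min \<alpha> \<beta>]\<close> with probability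
  \<open>2 * min \<alpha> \<beta> / (\<alpha> + \<beta>)\<close>, and otherwise equal to \<open>min \<alpha> \<beta>\<close>.
\<close>
definition gap_cdf :: "real \<Rightarrow> real \<Rightarrow> real \<Rightarrow> real" where
  "gap_cdf \<alpha> \<beta> x = (if x < 0 then 0 else if x < min \<alpha> \<beta> then 2 * x / (\<alpha> + \<beta>) else 1)"

lemma clock_step_swap: "clock_step \<beta> \<alpha> (prod.swap s) = prod.swap (clock_step \<alpha> \<beta> s)"
  by (auto simp: clock_step_def split: prod.split)

lemma clock_gap_swap: "clock_gap \<beta> \<alpha> (prod.swap s) k = clock_gap \<alpha> \<beta> s k"
proof -
  have "(clock_step \<beta> \<alpha> ^^ k) (prod.swap s) = prod.swap ((clock_step \<alpha> \<beta> ^^ k) s)"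
    by (induction k) (auto simp: clock_step_swap)
  then show ?thesis by (auto simp: clock_gap_def min.commute split: prod.split)
qed

lemma gap_cdf_swap: "gap_cdf \<beta> \<alpha> x = gap_cdf \<alpha> \<beta> x"
  by (auto simp: gap_cdf_def min_def add.commute)

lemma card_le_1I:
  assumes "\<And>x y. x \<in> A \<Longrightarrow> y \<in> A \<Longrightarrow> x = y"
  shows "card A \<le> 1"
proof (cases "A = {}")
  case False
  then obtain x where "A = {x}" using assms by blast
  then show ?thesis by simp
qed simp

lemma card_below_eq_sum: "card {k. k < n \<and> R k} = (\<Sum>k<n. of_bool (R k))" for n :: nat
proof (induction n)
  case (Suc n)
  have "{k. k < Suc n \<and> R k} = (if R n then insert n {k. k < n \<and> R k} else {k. k < n \<and> R k})"
    by (auto simp: less_Suc_eq)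
  then show ?case using Suc by simp
qed simp

text \<open>
  The clocks with periods \<open>\<alpha> < \<beta>\<close> are called short and long. After \<open>k\<close> steps, \<open>P k\<close> and \<open>Q k\<close> are
  the times until the next tick of the short and of the long clock, and \<open>short_ticks k\<close> and
  \<open>long_ticks k\<close> count the ticks so far.
\<close>
locale two_clocks =
  fixes \<alpha> \<beta> p0 q0 :: real
  assumes less: "0 < \<alpha>" "\<alpha> < \<beta>"
    and irrational: "\<beta> / \<alpha> \<notin> \<rat>"
    and start: "0 < p0" "p0 \<le> \<alpha>" "0 < q0" "q0 \<le> \<beta>"
begin

definition P :: "nat \<Rightarrow> real" where "P k = fst ((clock_step \<alpha> \<beta> ^^ k) (p0, q0))"
definition Q :: "nat \<Rightarrow> real" where "Q k = snd ((clock_step \<alpha> \<beta> ^^ k) (p0, q0))"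

lemma P_0 [simp]: "P 0 = p0" and Q_0 [simp]: "Q 0 = q0"
  by (simp_all add: P_def Q_def)

lemma P_Suc: "P (Suc k) = (if P k \<le> Q k then \<alpha> else P k - Q k)"
  and Q_Suc: "Q (Suc k) = (if Q k \<le> P k then \<beta> else Q k - P k)"
  by (simp_all add: P_def Q_def clock_step_def split: prod.split)

lemma gap: "clock_gap \<alpha> \<beta> (p0, q0) k = min (P k) (Q k)"
  by (simp add: clock_gap_def P_def Q_def split: prod.split)

lemma bounds: "0 < P k" "P k \<le> \<alpha>" "0 < Q k" "Q k \<le> \<beta>"
proof -
  have "0 < P k \<and> P k \<le> \<alpha> \<and> 0 < Q k \<and> Q k \<le> \<beta>"
    using less start by (induction k) (auto simp: P_Suc Q_Suc)
  then show "0 < P k" "P k \<le> \<alpha>" "0 < Q k" "Q k \<le> \<beta>" by auto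
qed

definition short_ticks :: "nat \<Rightarrow> nat" where "short_ticks n = (\<Sum>k<n. of_bool (P k \<le> Q k))"
definition long_ticks :: "nat \<Rightarrow> nat" where "long_ticks n = (\<Sum>k<n. of_bool (Q k \<le> P k))"

text \<open>
  Both clocks measure the same elapsed time, which cancels in the difference of the residual
  times.
\<close>
lemma balance: "P n - Q n = p0 - q0 + short_ticks n * \<alpha> - long_ticks n * \<beta>"
  by (induction n) (auto simp: P_Suc Q_Suc short_ticks_def long_ticks_def algebra_simps)

lemma long_ticks_mono: "m \<le> n \<Longrightarrow> long_ticks m \<le> long_ticks n"
  unfolding long_ticks_def by (intro sum_mono2) auto

text \<open>Two coincidences of ticks would exhibit \<open>\<beta> / \<alpha>\<close> as a ratio of numbers of ticks.\<close>
lemma at_most_one_tie: "card {k. k < n \<and> P k = Q k} \<le> 1"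
proof (rule card_le_1I, rule ccontr)
  have *: False if "P i = Q i" "P j = Q j" "i < j" for i j
  proof -
    have "long_ticks (Suc i) \<le> long_ticks j" using that by (intro long_ticks_mono) auto
    then have ticks: "long_ticks i < long_ticks j" using that by (simp add: long_ticks_def)
    have "real (short_ticks j) * \<alpha> - long_ticks j * \<beta> = short_ticks i * \<alpha> - long_ticks i * \<beta>"
      using balance[of i] balance[of j] that by linarith
    then have "\<beta> / \<alpha> = (real (short_ticks j) - short_ticks i) / (real (long_ticks j) - long_ticks i)"
      using ticks less by (simp add: field_simps)
    then show False using irrational by (simp add: Rats_divide Rats_diff)
  qed
  fix i j assume "i \<in> {k. k < n \<and> P k = Q k}" "j \<in> {k. k < n \<and> P k = Q k}" "i \<noteq> j"
  then show False using *[of i j] *[of j i] by (cases "i < j") auto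
qed

text \<open>
  The ticks of the two clocks occur in the ratio \<open>\<beta> : \<alpha>\<close> up to a bounded error, and every step
  contains exactly one tick, except for at most one tie.
\<close>
lemma long_ticks_bound: "\<bar>real (long_ticks n) * (\<alpha> + \<beta>) - n * \<alpha>\<bar> \<le> 3 * \<beta>"
proof -
  have "short_ticks n + long_ticks n = n + card {k. k < n \<and> P k = Q k}"
  proof -
    have "short_ticks n + long_ticks n = (\<Sum>k<n. 1 + of_bool (P k = Q k))"
      unfolding short_ticks_def long_ticks_def sum.distrib[symmetric] by (intro sum.cong) auto
    also have "\<dots> = n + card {k. k < n \<and> P k = Q k}"
      by (simp only: sum.distrib card_below_eq_sum) simp
    finally show ?thesis .
  qed
  then obtain t where t: "short_ticks n + long_ticks n = n + t" "t \<le> 1" using at_most_one_tie by auto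
  have "real (short_ticks n) = n + real t - long_ticks n" using t(1) by linarith
  then have "real (long_ticks n) * (\<alpha> + \<beta>) - n * \<alpha> = p0 - q0 - (P n - Q n) + t * \<alpha>"
    using balance[of n] unfolding \<open>real (short_ticks n) = n + real t - long_ticks n\<close> by (simp add: algebra_simps)
  moreover have "t = 0 \<or> t = 1" using t by linarith
  ultimately show ?thesis using bounds[of n] start less by (elim disjE) (simp_all add: abs_if)
qed

lemma long_ticks_asymp: "(\<lambda>n. long_ticks n / n) \<longlonglongrightarrow> \<alpha> / (\<alpha> + \<beta>)"
proof -
  have "(\<lambda>n. (real (long_ticks n) * (\<alpha> + \<beta>) - n * \<alpha>) / n) \<longlonglongrightarrow> 0"
  proof (rule Lim_null_comparison)
    show "\<forall>\<^sub>F n in sequentially. norm ((real (long_ticks n) * (\<alpha> + \<beta>) - n * \<alpha>) / n) \<le> 3 * \<beta> / real n"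
      using long_ticks_bound by (auto intro!: always_eventually divide_right_mono)
    show "(\<lambda>n. 3 * \<beta> / real n) \<longlonglongrightarrow> 0" by (rule lim_const_over_n)
  qed
  then have "(\<lambda>n. ((real (long_ticks n) * (\<alpha> + \<beta>) - n * \<alpha>) / n + \<alpha>) / (\<alpha> + \<beta>)) \<longlonglongrightarrow> (0 + \<alpha>) / (\<alpha> + \<beta>)"
    using less by (intro tendsto_intros) auto
  then show ?thesis
    using less by (elim filterlim_cong[THEN iffD1, rotated -1])
      (auto intro!: eventually_mono[OF eventually_gt_at_top[of 0]] simp: field_simps)
qed

lemma long_ticks_at_top: "filterlim long_ticks at_top sequentially"
proof -
  have "filterlim (\<lambda>n. long_ticks n / n * n) at_top sequentially"
    using long_ticks_asymp less by (intro filterlim_tendsto_pos_mult_at_top[OF long_ticks_asymp _ filterlim_real_sequentially]) auto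
  then have "filterlim (\<lambda>n. real (long_ticks n)) at_top sequentially"
    by (rule filterlim_cong[THEN iffD1, rotated -1])
       (auto intro!: eventually_mono[OF eventually_gt_at_top[of "0::nat"]] simp: long_ticks_def)
  then show ?thesis by (simp add: filterlim_sequentially_iff_filterlim_real)
qed

text \<open>
  The position of the \<open>j\<close>-th tick of the long clock within the period of the short clock that
  contains it, as a fraction of that period. It is the orbit of a rotation by \<open>\<beta> / \<alpha>\<close>.
\<close>
definition offset :: "nat \<Rightarrow> real" where "offset j = frac (((q0 - p0) / \<alpha>) + j * (\<beta> / \<alpha>))"

text \<open>
  By the balance of elapsed times, the residual time of the short clock after a long tick is
  determined modulo \<open>\<alpha>\<close> by the number of long ticks, and it lies in \<open>(0, \<alpha>]\<close>.
\<close>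
lemma P_after_long_tick:
  assumes "Q k \<le> P k"
  shows "P (Suc k) = \<alpha> * (1 - offset (long_ticks k))"
proof -
  have "P (Suc k) - \<beta> = p0 - q0 + short_ticks (Suc k) * \<alpha> - (long_ticks k + 1) * \<beta>"
    using balance[of "Suc k"] assms by (simp add: Q_Suc long_ticks_def)
  then have "P (Suc k) = p0 - q0 + short_ticks (Suc k) * \<alpha> - long_ticks k * \<beta>" by (simp add: algebra_simps)
  then have "(q0 - p0 + long_ticks k * \<beta> + P (Suc k)) / \<alpha> = short_ticks (Suc k)" using less by simp
  then have "((q0 - p0) / \<alpha>) + long_ticks k * (\<beta> / \<alpha>) - (1 - P (Suc k) / \<alpha>) = of_int (int (short_ticks (Suc k)) - 1)"
    by (simp add: add_divide_distrib diff_divide_distrib algebra_simps)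
  then have "offset (long_ticks k) = 1 - P (Suc k) / \<alpha>"
    unfolding offset_def using bounds[of "Suc k"] less by (intro frac_eqI[of _ _ "int (short_ticks (Suc k)) - 1"]) auto
  then show ?thesis using less by (simp add: field_simps)
qed

text \<open>Counting over the steps that contain a long tick is counting over the long ticks.\<close>
lemma sum_long_ticks: "(\<Sum>k<n. of_bool (Q k \<le> P k \<and> R (long_ticks k))) = card {j. j < long_ticks n \<and> R j}"
proof (induction n)
  case 0 show ?case by (simp add: long_ticks_def)
next
  case (Suc n)
  have ticks: "long_ticks (Suc n) = long_ticks n + of_bool (Q n \<le> P n)" by (simp add: long_ticks_def)
  have "{j. j < Suc (long_ticks n) \<and> R j} = (if R (long_ticks n) then insert (long_ticks n) {j. j < long_ticks n \<and> R j} else {j. j < long_ticks n \<and> R j})"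
    by (auto simp: less_Suc_eq)
  then show ?case using Suc by (simp add: ticks)
qed

text \<open>
  A gap shorter than \<open>\<alpha>\<close> has a long tick at exactly one of its ends. If the tick is at the left end,
  then the gap is the residual time of the short clock after it; if it is at the right end, then
  the gap is \<open>\<alpha>\<close> minus that residual time. The strict inequality \<open>P (Suc (Suc k)) < \<alpha>\<close> excludes ties, where the
  short clock has just been reset.
\<close>
lemma short_gap_iff:
  assumes x: "0 \<le> x" "x < \<alpha>"
  shows "(of_bool (min (P (Suc k)) (Q (Suc k)) \<le> x) :: nat) =
     of_bool (Q k \<le> P k \<and> P (Suc k) \<le> x) +
     of_bool (Q (Suc k) \<le> P (Suc k) \<and> \<alpha> - x \<le> P (Suc (Suc k)) \<and> P (Suc (Suc k)) < \<alpha>)"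
proof (cases "Q k \<le> P k")
  case True
  then show ?thesis using bounds[of "Suc k"] less by (auto simp: Q_Suc[of k] min_def)
next
  case False
  then show ?thesis using bounds[of "Suc k"] less x
    by (auto simp: P_Suc[of k] P_Suc[of "Suc k"] min_def)
qed

text \<open>
  The two boundary terms belong to the first gap, which need not start at a tick, and to the tick
  that ends it.
\<close>
lemma count_short_gaps:
  assumes x: "0 \<le> x" "x < \<alpha>"
  shows "card {k. k < Suc n \<and> clock_gap \<alpha> \<beta> (p0, q0) k \<le> x} +
      of_bool (Q 0 \<le> P 0 \<and> offset 0 \<le> x / \<alpha> \<and> 0 < offset 0) =
      of_bool (min p0 q0 \<le> x) + card {j. j < long_ticks n \<and> 1 - x / \<alpha> \<le> offset j} +
      card {j. j < long_ticks (Suc n) \<and> offset j \<le> x / \<alpha> \<and> 0 < offset j}"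
proof -
  let ?a = "\<lambda>k. of_bool (Q k \<le> P k \<and> 1 - x / \<alpha> \<le> offset (long_ticks k)) :: nat"
  let ?b = "\<lambda>k. of_bool (Q k \<le> P k \<and> offset (long_ticks k) \<le> x / \<alpha> \<and> 0 < offset (long_ticks k)) :: nat"
  have a: "Q k \<le> P k \<and> P (Suc k) \<le> x \<longleftrightarrow> Q k \<le> P k \<and> 1 - x / \<alpha> \<le> offset (long_ticks k)" for k
    using P_after_long_tick[of k] less by (auto simp: field_simps)
  have b: "Q k \<le> P k \<and> \<alpha> - x \<le> P (Suc k) \<and> P (Suc k) < \<alpha> \<longleftrightarrow>
      Q k \<le> P k \<and> offset (long_ticks k) \<le> x / \<alpha> \<and> 0 < offset (long_ticks k)" for k
  proof (cases "Q k \<le> P k")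
    case True
    have "P (Suc k) < \<alpha> \<longleftrightarrow> 0 < \<alpha> * offset (long_ticks k)"
      unfolding P_after_long_tick[OF True] by (simp add: algebra_simps)
    then have "P (Suc k) < \<alpha> \<longleftrightarrow> 0 < offset (long_ticks k)" using less by (simp add: zero_less_mult_iff)
    moreover have "\<alpha> - x \<le> P (Suc k) \<longleftrightarrow> offset (long_ticks k) \<le> x / \<alpha>"
      unfolding P_after_long_tick[OF True] using less by (simp add: field_simps)
    ultimately show ?thesis by simp
  qed simp
  have "card {k. k < Suc n \<and> min (P k) (Q k) \<le> x} = (\<Sum>k<Suc n. of_bool (min (P k) (Q k) \<le> x))"
    by (rule card_below_eq_sum)
  also have "\<dots> = of_bool (min p0 q0 \<le> x) + (\<Sum>k<n. ?a k + ?b (Suc k))"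
    unfolding sum.lessThan_Suc_shift short_gap_iff[OF x] a b by simp
  finally have "card {k. k < Suc n \<and> min (P k) (Q k) \<le> x} + ?b 0 = 
     of_bool (min p0 q0 \<le> x) + (\<Sum>k<n. ?a k) + (\<Sum>k<Suc n. ?b k)"
    unfolding sum.distrib sum.lessThan_Suc_shift by simp
  also have "(\<Sum>k<n. ?a k) = card {j. j < long_ticks n \<and> 1 - x / \<alpha> \<le> offset j}"
    by (rule sum_long_ticks)
  also have "(\<Sum>k<Suc n. ?b k) = card {j. j < long_ticks (Suc n) \<and> offset j \<le> x / \<alpha> \<and> 0 < offset j}"
    by (rule sum_long_ticks)
  finally show ?thesis by (simp add: gap long_ticks_def)
qed

text \<open>
  The two families of short gaps correspond to offsets in \<open>[1 - y, 1)\<close> and in \<open>(0, y]\<close>. Arcs are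
  closed on the left and open on the right, so the second family is counted along the reversed
  rotation.
\<close>
lemma freq_top:
  assumes "0 \<le> y" "y \<le> 1"
  shows "(\<lambda>n. card {j. j < n \<and> 1 - y \<le> offset j} / n) \<longlonglongrightarrow> y"
proof -
  have "(\<lambda>n. arc_hits (\<lambda>j. (q0 - p0) / \<alpha> + j * (\<beta> / \<alpha>)) (1 - y) y n / n) \<longlonglongrightarrow> y"
    by (rule irrational_rotation_equidistributed[OF irrational assms])
  moreover have "frac (z - (1 - y)) < y \<longleftrightarrow> 1 - y \<le> frac z" if "y \<noteq> 0" for z :: real
  proof -
    have "frac (z - (1 - y)) = (if frac z < 1 - y then frac z + y else frac z - (1 - y))"
      using assms that frac_lt_1[of z] frac_ge_0[of z]
      by (intro frac_eqI[of _ _ "if frac z < 1 - y then \<lfloor>z\<rfloor> - 1 else \<lfloor>z\<rfloor>"])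
         (auto simp: frac_def simp del: frac_ge_0)
    then show ?thesis using frac_lt_1[of z] frac_ge_0[of z] by (auto simp del: frac_ge_0)
  qed
  moreover have "\<not> 1 \<le> frac z" for z :: real using frac_lt_1[of z] by simp
  ultimately show ?thesis by (cases "y = 0") (simp_all add: arc_hits_def offset_def)
qed

lemma freq_bottom:
  assumes "0 \<le> y" "y < 1"
  shows "(\<lambda>n. card {j. j < n \<and> offset j \<le> y \<and> 0 < offset j} / n) \<longlonglongrightarrow> y"
proof -
  have irr: "- (\<beta> / \<alpha>) \<notin> \<rat>" using irrational Rats_minus_iff by blast
  have lim: "(\<lambda>n. arc_hits (\<lambda>j. (p0 - q0) / \<alpha> + j * (- (\<beta> / \<alpha>))) (1 - y) y n / n) \<longlonglongrightarrow> y"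
    by (rule irrational_rotation_equidistributed[OF irr]) (use assms in auto)
  have "frac (- z - (1 - y)) < y \<longleftrightarrow> frac z \<le> y \<and> 0 < frac z" if "y \<noteq> 0" for z :: real
  proof -
    define f where "f = frac z"
    have f: "0 \<le> f" "f < 1" "z = f + \<lfloor>z\<rfloor>" unfolding f_def by (rule frac_ge_0, rule frac_lt_1, simp add: frac_def)
    have "frac (- z - (1 - y)) = (if f = 0 then y else if y < f then 1 - f + y else y - f)"
      using assms that f
      by (intro frac_eqI[of _ _ "if f = 0 then - \<lfloor>z\<rfloor> - 1 else if y < f then - \<lfloor>z\<rfloor> - 2 else - \<lfloor>z\<rfloor> - 1"])
         (auto split: if_splits)
    then show ?thesis using f assms that by (auto simp: f_def[symmetric] simp del: frac_gt_0_iff frac_eq_0_iff)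
  qed
  moreover have "frac (- z - (1 - y)) < y \<longleftrightarrow> frac z \<le> y \<and> 0 < frac z" if "y = 0" for z :: real
    using that frac_ge_0[of "- z - (1 - y)"] by linarith
  ultimately have key: "frac (- z - (1 - y)) < y \<longleftrightarrow> frac z \<le> y \<and> 0 < frac z" for z :: real
    by blast
  have "- ((q0 - p0) / \<alpha> + j * (\<beta> / \<alpha>)) = (p0 - q0) / \<alpha> + j * (- (\<beta> / \<alpha>))" for j :: nat
    by (simp add: diff_divide_distrib)
  then have "frac ((p0 - q0) / \<alpha> + j * (- (\<beta> / \<alpha>)) - (1 - y)) < y \<longleftrightarrow> offset j \<le> y \<and> 0 < offset j" for j :: nat
    unfolding offset_def by (metis key)
  then show ?thesis using lim by (simp only: arc_hits_def)
qed

text \<open>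
  Each family has \<open>x / \<alpha>\<close> members per long tick, and there are \<open>\<alpha> / (\<alpha> + \<beta>)\<close> long ticks per step.
\<close>
lemma gap_frequency_short:
  assumes x: "0 \<le> x" "x < \<alpha>"
  shows "(\<lambda>n. card {k. k < n \<and> clock_gap \<alpha> \<beta> (p0, q0) k \<le> x} / n) \<longlonglongrightarrow> 2 * x / (\<alpha> + \<beta>)"
proof -
  let ?y = "x / \<alpha>" and ?r = "\<alpha> / (\<alpha> + \<beta>)"
  define A where "A n = card {j. j < n \<and> 1 - ?y \<le> offset j}" for n
  define B where "B n = card {j. j < n \<and> offset j \<le> ?y \<and> 0 < offset j}" for n
  define N where "N n = card {k. k < n \<and> clock_gap \<alpha> \<beta> (p0, q0) k \<le> x}" for n
  have y: "0 \<le> ?y" "?y < 1" using x less by auto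
  have A0: "A 0 = 0" and B0: "B 0 = 0" by (auto simp: A_def B_def)
  have A: "(\<lambda>n. A (long_ticks n) / n) \<longlonglongrightarrow> ?y * ?r"
  proof -
    have "(\<lambda>n. (A (long_ticks n) / long_ticks n) * (long_ticks n / n)) \<longlonglongrightarrow> ?y * ?r"
      unfolding A_def using filterlim_compose[OF freq_top[OF y(1) less_imp_le[OF y(2)]] long_ticks_at_top]
      by (intro tendsto_mult long_ticks_asymp)
    moreover have "(A (long_ticks n) / long_ticks n) * (long_ticks n / n) = A (long_ticks n) / n" for n by (cases "long_ticks n = 0") (auto simp: A0)
    ultimately show ?thesis by (simp only:)
  qed
  have B: "(\<lambda>n. B (long_ticks n) / n) \<longlonglongrightarrow> ?y * ?r"
  proof -
    have "(\<lambda>n. (B (long_ticks n) / long_ticks n) * (long_ticks n / n)) \<longlonglongrightarrow> ?y * ?r"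
      unfolding B_def using filterlim_compose[OF freq_bottom[OF y] long_ticks_at_top]
      by (intro tendsto_mult long_ticks_asymp)
    moreover have "(B (long_ticks n) / long_ticks n) * (long_ticks n / n) = B (long_ticks n) / n" for n by (cases "long_ticks n = 0") (auto simp: B0)
    ultimately show ?thesis by (simp only:)
  qed
  define c :: real where "c = of_bool (min p0 q0 \<le> x) - of_bool (Q 0 \<le> P 0 \<and> offset 0 \<le> ?y \<and> 0 < offset 0)"
  have N: "real (N (Suc n)) = c + A (long_ticks n) + B (long_ticks (Suc n))" for n
  proof -
    have "real (N (Suc n) + of_bool (Q 0 \<le> P 0 \<and> offset 0 \<le> ?y \<and> 0 < offset 0)) =
        real (of_bool (min p0 q0 \<le> x) + A (long_ticks n) + B (long_ticks (Suc n)))"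
      using count_short_gaps[OF x, of n] unfolding A_def B_def N_def by (rule arg_cong)
    then show ?thesis unfolding c_def by (simp only: of_nat_add of_nat_of_bool)
  qed
  have "(\<lambda>n. c / real (Suc n) + (A (long_ticks n) / n) * (n / real (Suc n)) + B (long_ticks (Suc n)) / real (Suc n))
      \<longlonglongrightarrow> 0 + ?y * ?r * 1 + ?y * ?r"
    using LIMSEQ_Suc[OF B] LIMSEQ_Suc[OF lim_const_over_n[of c]]
    by (intro tendsto_add tendsto_mult A LIMSEQ_n_over_Suc_n) auto
  moreover have "c / real (Suc n) + (A (long_ticks n) / n) * (n / real (Suc n)) + B (long_ticks (Suc n)) / real (Suc n) =
     N (Suc n) / Suc n" for n
    unfolding N by (cases "n = 0") (auto simp: add_divide_distrib long_ticks_def A0)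
  moreover have "0 + ?y * ?r * 1 + ?y * ?r = 2 * x / (\<alpha> + \<beta>)" using less by simp
  ultimately have "(\<lambda>n. N (Suc n) / Suc n) \<longlonglongrightarrow> 2 * x / (\<alpha> + \<beta>)" by (simp only:)
  then show ?thesis unfolding N_def by (rule LIMSEQ_imp_Suc)
qed

lemma gap_frequency:
  "(\<lambda>n. card {k. k < n \<and> clock_gap \<alpha> \<beta> (p0, q0) k \<le> x} / n) \<longlonglongrightarrow> gap_cdf \<alpha> \<beta> x"
proof -
  consider "x < 0" | "0 \<le> x" "x < \<alpha>" | "\<alpha> \<le> x" by linarith
  then show ?thesis
  proof cases
    case 1
    then have "\<not> clock_gap \<alpha> \<beta> (p0, q0) k \<le> x" for k using bounds[of k] by (auto simp: gap)
    then show ?thesis using 1 by (simp add: gap_cdf_def)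
  next
    case 2
    then show ?thesis using gap_frequency_short less by (simp add: gap_cdf_def)
  next
    case 3
    then have "clock_gap \<alpha> \<beta> (p0, q0) k \<le> x" for k using bounds[of k] by (auto simp: gap)
    moreover have "(\<lambda>n. real n / real n) \<longlonglongrightarrow> 1"
      by (rule tendsto_eventually) (auto intro!: eventually_mono[OF eventually_gt_at_top[of "0::nat"]])
    ultimately show ?thesis using 3 less by (simp add: gap_cdf_def)
  qed
qed

end

lemma two_clocks_gap_frequency:
  assumes "0 < \<alpha>" "0 < \<beta>" "\<beta> / \<alpha> \<notin> \<rat>" "0 < p" "p \<le> \<alpha>" "0 < q" "q \<le> \<beta>"
  shows "(\<lambda>n. card {k. k < n \<and> clock_gap \<alpha> \<beta> (p, q) k \<le> x} / n) \<longlonglongrightarrow> gap_cdf \<alpha> \<beta> x"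
proof -
  have "\<alpha> \<noteq> \<beta>" using assms by auto
  then consider "\<alpha> < \<beta>" | "\<beta> < \<alpha>" by linarith
  then show ?thesis
  proof cases
    case 1
    then interpret two_clocks \<alpha> \<beta> p q using assms by unfold_locales auto
    show ?thesis by (rule gap_frequency)
  next
    case 2
    have "\<alpha> / \<beta> \<notin> \<rat>" using assms(3) Rats_inverse[of "\<alpha> / \<beta>"] by auto
    with 2 interpret two_clocks \<beta> \<alpha> q p using assms by unfold_locales auto
    show ?thesis
      using gap_frequency[of x] clock_gap_swap[of \<beta> \<alpha> "(p, q)"] by (simp add: gap_cdf_swap)
  qed
qed

section \<open>Billiard trajectories as two clocks\<close>

definition phase_space :: "real \<Rightarrow> real \<Rightarrow> ((real \<times> real) \<times> (real \<times> real)) set" where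
  "phase_space a b = rectangle a b \<times> sphere 0 1"

lemma rectangle_convex_compact_closed:
  shows "convex (rectangle a b)" "compact (rectangle a b)" "closed (rectangle a b)"
  by (auto simp: rectangle_def intro!: convex_Times compact_Times closed_Times)

text \<open>
  The times that the straight line spends in the rectangle form a set that is closed and bounded
  by compactness and an interval by convexity, so the supremum behaves like an exit time. This
  characterization is used both to compute the flight time and to prove it measurable, where it avoids a case
  distinction for directions parallel to a side.
\<close>
lemma flight_time_ge_iff:
  assumes p: "p \<in> rectangle a b" and v: "norm v = 1" and t: "0 \<le> t"
  shows "t \<le> flight_time a b (p, v) \<longleftrightarrow> p + t *\<^sub>R v \<in> rectangle a b"
    and "0 \<le> flight_time a b (p, v)"
proof -
  define S where "S = {t. 0 \<le> t \<and> p + t *\<^sub>R v \<in> rectangle a b}"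
  obtain B where B: "\<And>q. q \<in> rectangle a b \<Longrightarrow> norm q \<le> B"
    using compact_imp_bounded[OF rectangle_convex_compact_closed(2)] unfolding bounded_iff by blast
  have "t \<le> 2 * B" if "t \<in> S" for t
  proof -
    have "t = norm ((p + t *\<^sub>R v) - p)" using that v by (simp add: S_def)
    also have "\<dots> \<le> norm (p + t *\<^sub>R v) + norm p" by (rule norm_triangle_ineq4)
    also have "\<dots> \<le> 2 * B" using B[of p] B[of "p + t *\<^sub>R v"] that p by (simp add: S_def)
    finally show ?thesis .
  qed
  then have bdd: "bdd_above S" by (meson bdd_aboveI)
  have "S = {0..} \<inter> (\<lambda>t. p + t *\<^sub>R v) -` rectangle a b" by (auto simp: S_def)
  moreover have "closed ((\<lambda>t. p + t *\<^sub>R v) -` rectangle a b)"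
    by (intro closed_vimage rectangle_convex_compact_closed continuous_intros)
  ultimately have cl: "closed S" by auto
  have zero: "0 \<in> S" using p by (simp add: S_def)
  have flight: "flight_time a b (p, v) = Sup S" by (simp add: flight_time_def S_def)
  have mem: "Sup S \<in> S" using zero bdd cl by (intro closed_contains_Sup) auto
  then show "0 \<le> flight_time a b (p, v)" by (simp add: flight S_def)
  show "t \<le> flight_time a b (p, v) \<longleftrightarrow> p + t *\<^sub>R v \<in> rectangle a b"
  proof
    assume le: "t \<le> flight_time a b (p, v)"
    show "p + t *\<^sub>R v \<in> rectangle a b"
    proof (cases "Sup S = 0")
      case True
      then show ?thesis using le t p by (simp add: flight)
    next
      case False
      then have pos: "0 < Sup S" using mem by (simp add: S_def)
      define u where "u = t / Sup S"
      have u: "0 \<le> u" "u \<le> 1" "u * Sup S = t" using le t pos by (auto simp: u_def flight)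
      \<comment> \<open>the point at time \<open>t\<close> lies on the segment from the initial point to the exit point\<close>
      have "(1 - u) *\<^sub>R p + u *\<^sub>R (p + Sup S *\<^sub>R v) \<in> rectangle a b"
        using rectangle_convex_compact_closed(1) p mem u by (intro convexD) (auto simp: S_def)
      also have "(1 - u) *\<^sub>R p + u *\<^sub>R (p + Sup S *\<^sub>R v) = p + (u * Sup S) *\<^sub>R v"
        by (simp add: algebra_simps)
      finally show ?thesis by (simp add: u)
    qed
  next
    assume "p + t *\<^sub>R v \<in> rectangle a b"
    then have "t \<in> S" using t by (simp add: S_def)
    then show "t \<le> flight_time a b (p, v)" unfolding flight by (rule cSup_upper[OF _ bdd])
  qed
qed

lemma bounce_in_phase_space:
  assumes "s \<in> phase_space a b"
  shows "bounce a b s \<in> phase_space a b"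
proof -
  obtain p v where s: "s = (p, v)" by (metis surj_pair)
  have p: "p \<in> rectangle a b" and v: "norm v = 1" using assms by (auto simp: s phase_space_def)
  have "p + flight_time a b (p, v) *\<^sub>R v \<in> rectangle a b"
    using flight_time_ge_iff[OF p v] by blast
  moreover have "norm (reflect a b q v) = 1" for q
    using v by (cases q, cases v) (simp add: reflect_def norm_Pair)
  ultimately show ?thesis by (simp add: s bounce_def phase_space_def Let_def)
qed

lemma bounce_iterate_in_phase_space:
  "s \<in> phase_space a b \<Longrightarrow> (bounce a b ^^ k) s \<in> phase_space a b"
  by (induction k) (auto intro: bounce_in_phase_space)

lemma dist_bounce_point:
  assumes "s \<in> phase_space a b"
  shows "dist (bounce_point a b s k) (bounce_point a b s (k + 1)) = flight_time a b ((bounce a b ^^ k) s)"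
proof -
  obtain p v where s: "(bounce a b ^^ k) s = (p, v)" by (metis surj_pair)
  have p: "p \<in> rectangle a b" and v: "norm v = 1"
    using bounce_iterate_in_phase_space[OF assms, of k] by (auto simp: s phase_space_def)
  have "bounce_point a b s (k + 1) = p + flight_time a b (p, v) *\<^sub>R v"
    by (simp add: bounce_point_def s) (simp add: bounce_def Let_def)
  moreover have "bounce_point a b s k = p" by (simp add: bounce_point_def s)
  ultimately show ?thesis
    using v flight_time_ge_iff(2)[OF p v order_refl] by (simp add: s dist_norm)
qed

text \<open>
  The time until a point at \<open>x\<close> in \<open>[0, L]\<close> that moves with velocity \<open>v\<close> meets the end it is heading for.
\<close>
definition wall_clock :: "real \<Rightarrow> real \<Rightarrow> real \<Rightarrow> real" where
  "wall_clock L x v = (if v > 0 then L - x else x) / \<bar>v\<bar>"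

definition clocks :: "real \<Rightarrow> real \<Rightarrow> (real \<times> real) \<times> (real \<times> real) \<Rightarrow> real \<times> real" where
  "clocks a b = (\<lambda>((x, y), (v, w)). (wall_clock a x v, wall_clock b y w))"

lemma wall_clock_bounds:
  assumes "0 \<le> x" "x \<le> L" "v \<noteq> 0"
  shows "0 \<le> wall_clock L x v" "wall_clock L x v \<le> L / \<bar>v\<bar>"
  using assms unfolding wall_clock_def by (simp_all add: divide_right_mono)

lemma wall_clock_ge_iff:
  assumes "0 \<le> x" "x \<le> L" "v \<noteq> 0" "0 \<le> t"
  shows "t \<le> wall_clock L x v \<longleftrightarrow> 0 \<le> x + t * v \<and> x + t * v \<le> L"
proof (cases "v > 0")
  case True
  then have "0 \<le> t * v" using assms by simp
  then show ?thesis using True assms by (auto simp: wall_clock_def field_simps)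
next
  case False
  then have "t * v \<le> 0" "v < 0" using assms by (auto simp: mult_nonneg_nonpos)
  then show ?thesis using assms by (auto simp: wall_clock_def field_simps)
qed

text \<open>
  Reflection in one coordinate is a clock with period \<open>L / \<bar>v\<bar>\<close>: the clock runs down with
  time, and reaching the end flips the velocity, after which the whole side has to be crossed.
\<close>
lemma wall_clock_advance:
  assumes "0 < L" "0 \<le> x" "x \<le> L" "v \<noteq> 0" "0 \<le> t" "t \<le> wall_clock L x v"
  defines "x' \<equiv> x + t * v"
  shows "wall_clock L x' (if x' = 0 \<and> v < 0 \<or> x' = L \<and> v > 0 then - v else v) =
    (if t = wall_clock L x v then L / \<bar>v\<bar> else wall_clock L x v - t)"
proof (cases "v > 0")
  case True
  have "x' = L \<longleftrightarrow> t = wall_clock L x v" using True by (auto simp: x'_def wall_clock_def field_simps)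
  moreover have "(L - x') / v = (L - x) / v - t" using True by (simp add: x'_def field_simps)
  ultimately show ?thesis using True by (auto simp: wall_clock_def)
next
  case False
  then have v: "v < 0" using assms by simp
  have "x' = 0 \<longleftrightarrow> t = wall_clock L x v" using v by (auto simp: x'_def wall_clock_def field_simps)
  moreover have "x' / \<bar>v\<bar> = x / \<bar>v\<bar> - t" using v by (simp add: x'_def field_simps)
  ultimately show ?thesis using v by (auto simp: wall_clock_def)
qed

lemma flight_time_eq_clocks:
  assumes "((x, y), (v, w)) \<in> phase_space a b" "v \<noteq> 0" "w \<noteq> 0"
  shows "flight_time a b ((x, y), (v, w)) = min (wall_clock a x v) (wall_clock b y w)"
proof -
  have p: "(x, y) \<in> rectangle a b" "norm (v, w) = 1" using assms by (auto simp: phase_space_def)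
  have xy: "0 \<le> x" "x \<le> a" "0 \<le> y" "y \<le> b" using p by (auto simp: rectangle_def)
  let ?F = "flight_time a b ((x, y), (v, w))" and ?m = "min (wall_clock a x v) (wall_clock b y w)"
  have "t \<le> ?F \<longleftrightarrow> t \<le> ?m" if "0 \<le> t" for t
    using flight_time_ge_iff(1)[OF p that] wall_clock_ge_iff[OF xy(1,2) assms(2) that]
      wall_clock_ge_iff[OF xy(3,4) assms(3) that] by (auto simp: rectangle_def)
  moreover have "0 \<le> ?F" "0 \<le> ?m"
    using flight_time_ge_iff(2)[OF p order_refl] wall_clock_bounds(1)[OF xy(1,2) assms(2)]
      wall_clock_bounds(1)[OF xy(3,4) assms(3)] by auto
  ultimately show ?thesis by (meson antisym order_refl)
qed

text \<open>
  The coordinates are reflected independently, so a bounce acts on the two clocks as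
  \<open>clock_step\<close> does. A corner corresponds to a tie, and a particle that starts on a wall which it
  points out of has a clock that shows 0.
\<close>
lemma bounce_clocks:
  assumes "0 < a" "0 < b" "((x, y), (v, w)) \<in> phase_space a b" "v \<noteq> 0" "w \<noteq> 0"
  shows "clocks a b (bounce a b ((x, y), (v, w))) =
      clock_step (a / \<bar>v\<bar>) (b / \<bar>w\<bar>) (clocks a b ((x, y), (v, w)))"
    and "\<bar>fst (snd (bounce a b ((x, y), (v, w))))\<bar> = \<bar>v\<bar>"
    and "\<bar>snd (snd (bounce a b ((x, y), (v, w))))\<bar> = \<bar>w\<bar>"
proof -
  have xy: "0 \<le> x" "x \<le> a" "0 \<le> y" "y \<le> b" using assms(3) by (auto simp: rectangle_def phase_space_def)
  define p where "p = wall_clock a x v"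
  define q where "q = wall_clock b y w"
  define t where "t = min p q"
  have F: "flight_time a b ((x, y), (v, w)) = t"
    unfolding t_def p_def q_def by (rule flight_time_eq_clocks[OF assms(3-5)])
  have pq: "0 \<le> p" "0 \<le> q"
    unfolding p_def q_def using wall_clock_bounds xy assms by auto
  then have t: "0 \<le> t" "t \<le> p" "t \<le> q" by (auto simp: t_def)
  have B: "bounce a b ((x, y), (v, w)) = ((x + t * v, y + t * w), 
     (if x + t * v = 0 \<and> v < 0 \<or> x + t * v = a \<and> v > 0 then - v else v),
      (if y + t * w = 0 \<and> w < 0 \<or> y + t * w = b \<and> w > 0 then - w else w))"
    by (simp add: bounce_def Let_def F reflect_def)
  show "\<bar>fst (snd (bounce a b ((x, y), (v, w))))\<bar> = \<bar>v\<bar>" "\<bar>snd (snd (bounce a b ((x, y), (v, w))))\<bar> = \<bar>w\<bar>"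
    by (auto simp: B)
  show "clocks a b (bounce a b ((x, y), (v, w))) =
      clock_step (a / \<bar>v\<bar>) (b / \<bar>w\<bar>) (clocks a b ((x, y), (v, w)))"
    unfolding B clocks_def prod.case
    using wall_clock_advance[OF assms(1) xy(1,2) assms(4) t(1) t(2)[unfolded p_def]]
      wall_clock_advance[OF assms(2) xy(3,4) assms(5) t(1) t(3)[unfolded q_def]]
    by (simp only: p_def[symmetric] q_def[symmetric] clock_step_def prod.case) (auto simp: t_def)
qed

lemma bounce_iterate_clocks:
  assumes "0 < a" "0 < b" "s \<in> phase_space a b" "fst (snd s) \<noteq> 0" "snd (snd s) \<noteq> 0"
  defines "\<alpha> \<equiv> a / \<bar>fst (snd s)\<bar>" and "\<beta> \<equiv> b / \<bar>snd (snd s)\<bar>"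
  shows "clocks a b ((bounce a b ^^ k) s) = (clock_step \<alpha> \<beta> ^^ k) (clocks a b s) \<and>
    \<bar>fst (snd ((bounce a b ^^ k) s))\<bar> = \<bar>fst (snd s)\<bar> \<and>
    \<bar>snd (snd ((bounce a b ^^ k) s))\<bar> = \<bar>snd (snd s)\<bar>"
proof (induction k)
  case (Suc k)
  obtain x y v w where r: "(bounce a b ^^ k) s = ((x, y), (v, w))" by (metis prod.collapse)
  have "((x, y), (v, w)) \<in> phase_space a b" using bounce_iterate_in_phase_space[OF assms(3), of k] by (simp add: r)
  moreover have vw: "\<bar>v\<bar> = \<bar>fst (snd s)\<bar>" "\<bar>w\<bar> = \<bar>snd (snd s)\<bar>" using Suc by (auto simp: r)
  moreover have "v \<noteq> 0" "w \<noteq> 0" using vw assms(4,5) by auto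
  ultimately show ?case using bounce_clocks[OF assms(1,2), of x y v w] Suc
    by (simp add: r \<alpha>_def \<beta>_def)
qed simp

lemma dist_bounce_point_eq_clock_gap:
  assumes "0 < a" "0 < b" "s \<in> phase_space a b" "fst (snd s) \<noteq> 0" "snd (snd s) \<noteq> 0"
  shows "dist (bounce_point a b s k) (bounce_point a b s (k + 1)) =
    clock_gap (a / \<bar>fst (snd s)\<bar>) (b / \<bar>snd (snd s)\<bar>) (clocks a b s) k"
proof -
  obtain x y v w where r: "(bounce a b ^^ k) s = ((x, y), (v, w))" by (metis prod.collapse)
  have "((x, y), (v, w)) \<in> phase_space a b" using bounce_iterate_in_phase_space[OF assms(3), of k] by (simp add: r)
  moreover have "v \<noteq> 0" "w \<noteq> 0" using bounce_iterate_clocks[OF assms, of k] assms(4,5) by (auto simp: r)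
  ultimately have "flight_time a b ((bounce a b ^^ k) s) = (case clocks a b ((bounce a b ^^ k) s) of (p, q) \<Rightarrow> min p q)"
    using flight_time_eq_clocks by (simp add: r clocks_def)
  then show ?thesis
    unfolding dist_bounce_point[OF assms(3)] clock_gap_def using bounce_iterate_clocks[OF assms, of k] by simp
qed

text \<open>
  The unrecorded segment before the first bounce also serves to bring the clocks into the range
  \<open>(0, \<alpha>]\<close> and \<open>(0, \<beta>]\<close>, as initially they may show 0.
\<close>
lemma bounce_length_frequency:
  assumes "0 < a" "0 < b" "s \<in> phase_space a b" "fst (snd s) \<noteq> 0" "snd (snd s) \<noteq> 0"
    and irr: "(b / \<bar>snd (snd s)\<bar>) / (a / \<bar>fst (snd s)\<bar>) \<notin> \<rat>"
  shows "(\<lambda>N. (\<Sum>k\<in>{1..<N}. indicator {..x} (dist (bounce_point a b s k) (bounce_point a b s (k + 1)))) / real (N - 1))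
    \<longlonglongrightarrow> gap_cdf (a / \<bar>fst (snd s)\<bar>) (b / \<bar>snd (snd s)\<bar>) x"
proof -
  define \<alpha> where "\<alpha> = a / \<bar>fst (snd s)\<bar>"
  define \<beta> where "\<beta> = b / \<bar>snd (snd s)\<bar>"
  have pos: "0 < \<alpha>" "0 < \<beta>" using assms by (auto simp: \<alpha>_def \<beta>_def)
  obtain p q where pq: "clocks a b s = (p, q)" by force
  have b: "0 \<le> p" "p \<le> \<alpha>" "0 \<le> q" "q \<le> \<beta>"
    using assms(3-5) pq wall_clock_bounds
    by (auto simp: phase_space_def rectangle_def clocks_def \<alpha>_def \<beta>_def split: prod.splits)
  obtain p' q' where pq': "clock_step \<alpha> \<beta> (p, q) = (p', q')" by force
  have b': "0 < p'" "p' \<le> \<alpha>" "0 < q'" "q' \<le> \<beta>"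
    using b pos pq' by (auto simp: clock_step_def split: if_splits)
  let ?d = "\<lambda>k. dist (bounce_point a b s k) (bounce_point a b s (k + 1))"
  have gap: "?d (Suc k) = clock_gap \<alpha> \<beta> (p', q') k" for k
    using dist_bounce_point_eq_clock_gap[OF assms(1-5), of "Suc k", folded \<alpha>_def \<beta>_def]
    by (simp only: clock_gap_def pq funpow_Suc_right comp_apply pq')
  have "(\<lambda>n. (\<Sum>k\<in>{1..<Suc n}. indicator {..x} (?d k)) / real n) \<longlonglongrightarrow> gap_cdf \<alpha> \<beta> x"
  proof -
    have "(\<Sum>k\<in>{1..<Suc n}. indicator {..x} (?d k)) = real (card {k. k < n \<and> clock_gap \<alpha> \<beta> (p', q') k \<le> x})" for n
    proof -
      have "(\<Sum>k\<in>{1..<Suc n}. indicator {..x} (?d k) :: real) = (\<Sum>k<n. indicator {..x} (?d (Suc k)))"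
        by (rule sum.reindex_bij_witness[of _ Suc "\<lambda>k. k - 1"]) auto
      also have "\<dots> = (\<Sum>k<n. real (of_bool (clock_gap \<alpha> \<beta> (p', q') k \<le> x)))"
        unfolding gap by (simp add: indicator_def)
      also have "\<dots> = real (card {k. k < n \<and> clock_gap \<alpha> \<beta> (p', q') k \<le> x})"
        by (simp only: card_below_eq_sum of_nat_sum)
      finally show ?thesis .
    qed
    then show ?thesis
      using two_clocks_gap_frequency[OF pos irr[folded \<alpha>_def \<beta>_def] b'] by (simp only:)
  qed
  then show ?thesis
    unfolding \<alpha>_def \<beta>_def by - (rule LIMSEQ_imp_Suc, simp)
qed

section \<open>The distribution function averaged over directions\<close>

text \<open>
  An antiderivative of \<open>2 / (a / cos \<theta> + b / sin \<theta>)\<close> on the quadrant. Writing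
  \<open>a * sin \<theta> + b * cos \<theta>\<close> as the derivative of \<open>b * sin \<theta> - a * cos \<theta>\<close> explains the \<open>artanh\<close>: the
  squares of these two functions add up to \<open>a\<^sup>2 + b\<^sup>2\<close>.
\<close>
definition angle_integral :: "real \<Rightarrow> real \<Rightarrow> real \<Rightarrow> real" where
  "angle_integral a b \<theta> = (2 * a * sin \<theta> - 2 * b * cos \<theta>) / (a\<^sup>2 + b\<^sup>2)
     + 2 * a * b / (a\<^sup>2 + b\<^sup>2) powr (3/2) * artanh ((a * cos \<theta> - b * sin \<theta>) / sqrt (a\<^sup>2 + b\<^sup>2))"

text \<open>
  For directions \<open>\<theta>\<close> in the quadrant with \<open>\<theta> < wall_angle a x\<close> the clock period \<open>a / cos \<theta>\<close> is less than \<open>x\<close>.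
  The maximum makes this set of directions empty for \<open>x \<le> a\<close>.
\<close>
definition wall_angle :: "real \<Rightarrow> real \<Rightarrow> real" where
  "wall_angle a x = arccos (a / max a x)"

text \<open>
  The integral over the quadrant splits into two terms that are exchanged by swapping \<open>a\<close> with \<open>b\<close> and
  \<open>\<theta>\<close> with \<open>pi / 2 - \<theta>\<close>; this is one of them, and \<open>half_pdf\<close> is its derivative
  away from \<open>x = a\<close>.
\<close>
definition half_cdf :: "real \<Rightarrow> real \<Rightarrow> real \<Rightarrow> real" where
  "half_cdf a b x = wall_angle a x - x * angle_integral a b (wall_angle a x)"

text \<open>The diagonal \<open>sqrt (a\<^sup>2 + b\<^sup>2)\<close> is the longest possible bounce.\<close>
definition bounce_cdf :: "real \<Rightarrow> real \<Rightarrow> real \<Rightarrow> real" where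
  "bounce_cdf a b x =
    (if x < 0 then 0 else if x < sqrt (a\<^sup>2 + b\<^sup>2) then 2 / pi * (half_cdf a b x + half_cdf b a x) else 1)"

definition half_pdf :: "real \<Rightarrow> real \<Rightarrow> real \<Rightarrow> real" where
  "half_pdf a b t = (if t < a then 0 else
      a * (b - sqrt (t\<^sup>2 - a\<^sup>2)) / (t * (b + sqrt (t\<^sup>2 - a\<^sup>2)) * sqrt (t\<^sup>2 - a\<^sup>2)))
    - angle_integral a b (wall_angle a t)"

lemma powr_three_halves: "0 < s \<Longrightarrow> s powr (3/2) = s * sqrt s" for s :: real
  using powr_add[of s 1 "1/2"] by (simp add: powr_half_sqrt)

lemma projection_pos:
  fixes a b \<theta> :: real
  assumes "0 < a" "0 < b" "0 \<le> \<theta>" "\<theta> \<le> pi / 2"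
  shows "0 < a * sin \<theta> + b * cos \<theta>"
proof -
  have "0 \<le> sin \<theta>" "0 \<le> cos \<theta>" using assms by (auto intro: sin_ge_zero cos_ge_zero)
  moreover have "sin \<theta> \<noteq> 0 \<or> cos \<theta> \<noteq> 0" using sin_zero_abs_cos_one[of \<theta>] by auto
  ultimately show ?thesis using assms
    by (metis add_nonneg_pos add_pos_nonneg less_eq_real_def mult_nonneg_nonneg mult_pos_pos)
qed

lemma artanh_argument_bounds:
  fixes a b \<theta> :: real
  assumes "0 < a" "0 < b" "0 \<le> \<theta>" "\<theta> \<le> pi / 2"
  defines "u \<equiv> (a * cos \<theta> - b * sin \<theta>) / sqrt (a\<^sup>2 + b\<^sup>2)"
  shows "1 - u\<^sup>2 = (a * sin \<theta> + b * cos \<theta>)\<^sup>2 / (a\<^sup>2 + b\<^sup>2)" "\<bar>u\<bar> < 1"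
proof -
  have s: "0 < a\<^sup>2 + b\<^sup>2" using assms by (simp add: sum_power2_gt_zero_iff)
  have "(a * cos \<theta> - b * sin \<theta>)\<^sup>2 + (a * sin \<theta> + b * cos \<theta>)\<^sup>2 = (a\<^sup>2 + b\<^sup>2) * ((sin \<theta>)\<^sup>2 + (cos \<theta>)\<^sup>2)"
    by algebra
  then have "(a * cos \<theta> - b * sin \<theta>)\<^sup>2 + (a * sin \<theta> + b * cos \<theta>)\<^sup>2 = a\<^sup>2 + b\<^sup>2" by simp
  then have "((a * cos \<theta> - b * sin \<theta>)\<^sup>2 + (a * sin \<theta> + b * cos \<theta>)\<^sup>2) / (a\<^sup>2 + b\<^sup>2) = 1"
    using divide_self[OF less_imp_neq[OF s, symmetric]] by (simp only:)
  then show 1: "1 - u\<^sup>2 = (a * sin \<theta> + b * cos \<theta>)\<^sup>2 / (a\<^sup>2 + b\<^sup>2)"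
    unfolding u_def power_divide using s by (simp add: add_divide_distrib)
  have "0 < (a * sin \<theta> + b * cos \<theta>)\<^sup>2 / (a\<^sup>2 + b\<^sup>2)" using projection_pos[OF assms(1-4)] s by simp
  with 1 have "u\<^sup>2 < 1" by linarith
  then show "\<bar>u\<bar> < 1" by (simp add: abs_square_less_1)
qed

lemma angle_integral_deriv:
  assumes "0 < a" "0 < b" "0 \<le> \<theta>" "\<theta> \<le> pi / 2"
  shows "(angle_integral a b has_real_derivative
      2 * cos \<theta> * sin \<theta> / (a * sin \<theta> + b * cos \<theta>)) (at \<theta>)"
proof -
  define s where "s = a\<^sup>2 + b\<^sup>2"
  define r where "r = sqrt s"
  define g where "g = a * sin \<theta> + b * cos \<theta>"
  define u where "u = (a * cos \<theta> - b * sin \<theta>) / r"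
  have s: "0 < s" using assms by (simp add: s_def sum_power2_gt_zero_iff)
  have r: "0 < r" "r * r = s" "r\<^sup>2 = s" using s by (auto simp: r_def)
  have g: "0 < g" unfolding g_def by (rule projection_pos[OF assms])
  have u: "1 - u\<^sup>2 = g\<^sup>2 / s" "\<bar>u\<bar> < 1"
    unfolding u_def g_def r_def s_def using artanh_argument_bounds[OF assms] by auto
  have "((\<lambda>t. (a * cos t - b * sin t) / r) has_real_derivative - g / r) (at \<theta>)"
    unfolding g_def using r(1) by (auto intro!: derivative_eq_intros simp: field_simps)
  moreover have "(artanh has_real_derivative 1 / (1 - u\<^sup>2)) (at ((a * cos \<theta> - b * sin \<theta>) / r))"
    using u(2) unfolding u_def[symmetric] by (rule artanh_real_has_field_derivative)
  ultimately have "((\<lambda>t. artanh ((a * cos t - b * sin t) / r)) has_real_derivative (1 / (1 - u\<^sup>2)) * (- g / r)) (at \<theta>)"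
    by (rule DERIV_chain2[rotated])
  then have "((\<lambda>t. 2 * a * b / s powr (3/2) * artanh ((a * cos t - b * sin t) / r)) has_real_derivative
      2 * a * b / s powr (3/2) * ((1 / (1 - u\<^sup>2)) * (- g / r))) (at \<theta>)"
    by (rule DERIV_cmult)
  moreover have "((\<lambda>t. (2 * a * sin t - 2 * b * cos t) / s) has_real_derivative
      (2 * a * cos \<theta> + 2 * b * sin \<theta>) / s) (at \<theta>)"
    using s by (auto intro!: derivative_eq_intros)
  ultimately have "(angle_integral a b has_real_derivative
      (2 * a * cos \<theta> + 2 * b * sin \<theta>) / s + 2 * a * b / s powr (3/2) * ((1 / (1 - u\<^sup>2)) * (- g / r))) (at \<theta>)"
    unfolding angle_integral_def[abs_def] s_def[symmetric] r_def[symmetric] by (rule DERIV_add[rotated])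
  also have "2 * a * b / s powr (3/2) * ((1 / (1 - u\<^sup>2)) * (- g / r)) = - 2 * a * b / (s * g)"
    unfolding powr_three_halves[OF s] u r_def[symmetric] using s r(1) g r(2)[symmetric]
    by (simp add: field_simps power2_eq_square)
  also have "(2 * a * cos \<theta> + 2 * b * sin \<theta>) / s + - 2 * a * b / (s * g) =
      ((2 * a * cos \<theta> + 2 * b * sin \<theta>) * g - 2 * a * b) / (s * g)"
    using s g by (simp add: field_simps)
  also have "(2 * a * cos \<theta> + 2 * b * sin \<theta>) * g - 2 * a * b = 2 * cos \<theta> * sin \<theta> * s"
    using sin_cos_squared_add[of \<theta>] unfolding g_def s_def by algebra
  also have "2 * cos \<theta> * sin \<theta> * s / (s * g) = 2 * cos \<theta> * sin \<theta> / g" using s by simp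
  finally show ?thesis by (simp add: g_def)
qed

lemma angle_integral_mono:
  assumes "0 < a" "0 < b" "0 \<le> \<theta>1" "\<theta>1 \<le> \<theta>2" "\<theta>2 \<le> pi / 2"
  shows "angle_integral a b \<theta>1 \<le> angle_integral a b \<theta>2"
proof (rule DERIV_nonneg_imp_nondecreasing[OF assms(4)])
  fix t assume t: "\<theta>1 \<le> t" "t \<le> \<theta>2"
  then have "0 \<le> sin t" "0 \<le> cos t" using assms by (auto intro: sin_ge_zero cos_ge_zero)
  then have "0 \<le> 2 * cos t * sin t / (a * sin t + b * cos t)" using assms by auto
  then show "\<exists>y. (angle_integral a b has_real_derivative y) (at t) \<and> 0 \<le> y"
    using angle_integral_deriv[of a b t] assms t by auto
qed

lemma wall_angle_bounds:
  assumes "0 < a"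
  shows "0 \<le> wall_angle a x" "wall_angle a x < pi / 2" "cos (wall_angle a x) = a / max a x"
    "sin (wall_angle a x) = sqrt ((max a x)\<^sup>2 - a\<^sup>2) / max a x"
proof -
  define m where "m = max a x"
  have m: "0 < m" "a \<le> m" using assms by (auto simp: m_def)
  have q: "0 < a / m" "a / m \<le> 1" using m assms by auto
  have "arccos (a / m) < arccos 0" using q by (subst arccos_less_arccos) auto
  then show "wall_angle a x < pi / 2" "0 \<le> wall_angle a x" "cos (wall_angle a x) = a / max a x"
    using q unfolding wall_angle_def m_def[symmetric] by (auto simp: arccos_lbound)
  have "1 - (a / m)\<^sup>2 = (m\<^sup>2 - a\<^sup>2) / m\<^sup>2" using m by (simp add: power_divide diff_divide_distrib)
  moreover have "sin (arccos (a / m)) = sqrt (1 - (a / m)\<^sup>2)" using q by (intro sin_arccos_abs) auto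
  ultimately have "sin (arccos (a / m)) = sqrt (m\<^sup>2 - a\<^sup>2) / m"
    using m by (simp only: real_sqrt_divide) simp
  then show "sin (wall_angle a x) = sqrt ((max a x)\<^sup>2 - a\<^sup>2) / max a x"
    unfolding wall_angle_def m_def[symmetric] .
qed

lemma wall_angle_below: "0 < a \<Longrightarrow> x \<le> a \<Longrightarrow> wall_angle a x = 0"
  by (simp add: wall_angle_def max_absorb1)

lemma wall_angle_deriv_above:
  assumes "0 < a" "a < x"
  shows "(wall_angle a has_real_derivative a / (x * sqrt (x\<^sup>2 - a\<^sup>2))) (at x)"
proof -
  have eq: "1 - (a / x)\<^sup>2 = (x\<^sup>2 - a\<^sup>2) / x\<^sup>2" using assms by (simp add: power_divide diff_divide_distrib)
  have pos: "0 < x\<^sup>2 - a\<^sup>2" using assms by (simp add: power_strict_mono)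
  have "((\<lambda>x. arccos (a / x)) has_real_derivative 
      (inverse (- sqrt (1 - (a / x)\<^sup>2))) * (- (a / x\<^sup>2))) (at x)"
    using assms by (auto intro!: derivative_eq_intros simp: power2_eq_square divide_simps)
  also have "(inverse (- sqrt (1 - (a / x)\<^sup>2))) * (- (a / x\<^sup>2)) = a / (x * sqrt (x\<^sup>2 - a\<^sup>2))"
    unfolding eq using assms pos by (simp add: real_sqrt_divide field_simps power2_eq_square)
  finally show ?thesis
    by (rule has_field_derivative_transform_within_open[where S = "{a<..}"])
       (use assms in \<open>auto simp: wall_angle_def max_def\<close>)
qed

lemma sqrt_diff_less:
  assumes "0 < a" "0 < b" "a < x" "x < sqrt (a\<^sup>2 + b\<^sup>2)"
  shows "0 < sqrt (x\<^sup>2 - a\<^sup>2)" "sqrt (x\<^sup>2 - a\<^sup>2) < b" "x\<^sup>2 < a\<^sup>2 + b\<^sup>2"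
proof -
  have "0 < x\<^sup>2 - a\<^sup>2" using assms by (simp add: power_strict_mono)
  then show "0 < sqrt (x\<^sup>2 - a\<^sup>2)" by simp
  show x: "x\<^sup>2 < a\<^sup>2 + b\<^sup>2" using real_less_rsqrt[of x] assms by (smt (verit) real_sqrt_less_iff real_sqrt_abs)
  then show "sqrt (x\<^sup>2 - a\<^sup>2) < b" using assms by (intro real_less_lsqrt) auto
qed

lemma wall_angle_le:
  assumes "0 < a" "0 < b" "x \<le> sqrt (a\<^sup>2 + b\<^sup>2)"
  shows "wall_angle a x \<le> pi / 2 - wall_angle b x"
proof -
  note A = wall_angle_bounds[OF assms(1), of x] and B = wall_angle_bounds[OF assms(2), of x]
  consider "x \<le> a" | "x \<le> b" | "a < x" "b < x" by linarith
  then show ?thesis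
  proof cases
    case 3
    then have m: "max a x = x" "max b x = x" by auto
    have "x\<^sup>2 \<le> (sqrt (a\<^sup>2 + b\<^sup>2))\<^sup>2" using assms 3 by (intro power_mono) auto
    then have "sqrt (x\<^sup>2 - a\<^sup>2) \<le> b" using assms by (intro real_le_lsqrt) auto
    then have "sin (wall_angle a x) \<le> sin (pi / 2 - wall_angle b x)"
      using A B 3 assms unfolding m by (simp add: sin_diff divide_right_mono)
    then show ?thesis using A B by (subst (asm) sin_mono_le_eq) auto
  qed (use A B assms in \<open>auto simp: wall_angle_below\<close>)
qed

text \<open>
  For \<open>x > a\<close> the derivative of \<open>wall_angle\<close> enters with the factor \<open>1 - x * h\<close>, where \<open>h\<close> is the
  integrand of \<open>angle_integral\<close> at the direction with period \<open>\<alpha> = x\<close>. This factor equals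
  \<open>(\<beta> - \<alpha>) / (\<alpha> + \<beta>)\<close>, the proportion of the gaps that are equal to \<open>\<alpha>\<close>.
\<close>
lemma half_cdf_deriv:
  assumes "0 < a" "0 < b" "0 < x" "x \<noteq> a"
  shows "(half_cdf a b has_real_derivative half_pdf a b x) (at x)"
proof (cases "x < a")
  case True
  have "((\<lambda>x. - x * angle_integral a b 0) has_real_derivative - angle_integral a b 0) (at x)"
    by (auto intro!: derivative_eq_intros)
  then have "(half_cdf a b has_real_derivative - angle_integral a b 0) (at x)"
    by (rule has_field_derivative_transform_within_open[where S = "{..<a}"])
       (use assms True in \<open>auto simp: half_cdf_def wall_angle_below\<close>)
  then show ?thesis using True assms by (simp add: half_pdf_def wall_angle_below)
next
  case False
  define q where "q = sqrt (x\<^sup>2 - a\<^sup>2)"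
  define \<theta> where "\<theta> = wall_angle a x"
  have x: "a < x" using False assms by simp
  then have q: "0 < q" using assms by (simp add: q_def power_strict_mono)
  have \<theta>: "0 \<le> \<theta>" "\<theta> \<le> pi / 2" "cos \<theta> = a / x" "sin \<theta> = q / x"
    using wall_angle_bounds[OF assms(1), of x] x by (auto simp: \<theta>_def q_def max_def)
  note d = wall_angle_deriv_above[OF assms(1) x, folded q_def]
  have "(half_cdf a b has_real_derivative a / (x * q) - (angle_integral a b \<theta> +
      x * (2 * cos \<theta> * sin \<theta> / (a * sin \<theta> + b * cos \<theta>) * (a / (x * q))))) (at x)"
    unfolding half_cdf_def[abs_def]
    by (rule derivative_eq_intros DERIV_chain2[OF angle_integral_deriv[OF assms(1,2) \<theta>(1,2), unfolded \<theta>_def] d] d refl)+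
       (simp add: \<theta>_def)
  also have "a / (x * q) - (angle_integral a b \<theta> +
      x * (2 * cos \<theta> * sin \<theta> / (a * sin \<theta> + b * cos \<theta>) * (a / (x * q)))) = 
      a * (b - q) / (x * (b + q) * q) - angle_integral a b \<theta>"
  proof -
    have "a * sin \<theta> + b * cos \<theta> = a * (b + q) / x" using assms by (simp add: \<theta> field_simps)
    moreover have "b + q > 0" using q assms by simp
    ultimately have "x * (2 * cos \<theta> * sin \<theta> / (a * sin \<theta> + b * cos \<theta>) * (a / (x * q))) = 2 * a * q / (x * (b + q) * q)"
      using assms q by (simp add: \<theta>)
    moreover have "a / (x * q) = a * (b + q) / (x * (b + q) * q)" using assms q \<open>b + q > 0\<close> by simp
    ultimately show ?thesis by (simp only: diff_divide_distrib[symmetric] diff_diff_add) (simp add: add_divide_distrib diff_divide_distrib algebra_simps)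
  qed
  finally show ?thesis using False by (simp add: half_pdf_def q_def \<theta>_def)
qed

lemma artanh_add:
  fixes x y :: real
  assumes "\<bar>x\<bar> < 1" "\<bar>y\<bar> < 1"
  shows "artanh x + artanh y = artanh ((x + y) / (1 + x * y))"
proof -
  have "\<bar>x * y\<bar> < 1" using assms by (metis abs_ge_zero abs_mult abs_mult_less mult_1)
  then have p: "0 < 1 + x * y" by linarith
  have "1 + (x + y) / (1 + x * y) = (1 + x) * (1 + y) / (1 + x * y)"
    "1 - (x + y) / (1 + x * y) = (1 - x) * (1 - y) / (1 + x * y)"
    using p by (simp_all add: field_simps)
  then have "(1 + (x + y) / (1 + x * y)) / (1 - (x + y) / (1 + x * y)) = (1 + x) / (1 - x) * ((1 + y) / (1 - y))"
    using p by simp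
  moreover have "0 < (1 + x) / (1 - x)" "0 < (1 + y) / (1 - y)" using assms by auto
  ultimately show ?thesis unfolding artanh_def by (simp only: ln_mult) (simp add: add_divide_distrib)
qed

text \<open>
  Direct substitution gives a single \<open>artanh X\<close>; the addition theorem splits it into the difference that
  occurs in the density.
\<close>
lemma angle_integral_wall_angle:
  assumes "0 < a" "0 < b" "a < t" "t < sqrt (a\<^sup>2 + b\<^sup>2)"
  shows "angle_integral a b (wall_angle a t) =
    (2 * a * sqrt (t\<^sup>2 - a\<^sup>2) - 2 * a * b) / (t * (a\<^sup>2 + b\<^sup>2))
    + 2 * a * b / (a\<^sup>2 + b\<^sup>2) powr (3/2) * (artanh (t / sqrt (a\<^sup>2 + b\<^sup>2))
       - artanh (sqrt (t\<^sup>2 - a\<^sup>2) * sqrt (a\<^sup>2 + b\<^sup>2) / (t * b)))"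
proof -
  define q where "q = sqrt (t\<^sup>2 - a\<^sup>2)"
  define s where "s = a\<^sup>2 + b\<^sup>2"
  define R where "R = sqrt s"
  define \<theta> where "\<theta> = wall_angle a t"
  have q: "0 < q" "q < b" "t\<^sup>2 < s" using sqrt_diff_less[OF assms] by (auto simp: q_def s_def)
  have q2: "q\<^sup>2 = t\<^sup>2 - a\<^sup>2" using q assms by (simp add: q_def power_mono)
  have s: "0 < s" using assms by (simp add: s_def sum_power2_gt_zero_iff)
  have R: "0 < R" "R\<^sup>2 = s" using s by (auto simp: R_def)
  have t: "0 < t" using assms by simp
  have \<theta>: "0 \<le> \<theta>" "\<theta> \<le> pi / 2" "cos \<theta> = a / t" "sin \<theta> = q / t"
    using wall_angle_bounds[OF assms(1), of t] assms by (auto simp: \<theta>_def q_def max_def)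
  define X where "X = (a * cos \<theta> - b * sin \<theta>) / R"
  define Y where "Y = q * R / (t * b)"
  have X1: "\<bar>X\<bar> < 1" using artanh_argument_bounds[OF assms(1,2) \<theta>(1,2)] by (simp add: X_def R_def s_def)
  have Xeq: "X = (a\<^sup>2 - b * q) / (t * R)" using t R by (simp add: X_def \<theta> field_simps power2_eq_square)
  have "(q * R)\<^sup>2 < (t * b)\<^sup>2"
  proof -
    have "(t * b)\<^sup>2 - (q * R)\<^sup>2 = a\<^sup>2 * (s - t\<^sup>2)" unfolding power_mult_distrib R q2 s_def by algebra
    also have "\<dots> > 0" using q assms by simp
    finally show ?thesis by simp
  qed
  then have "q * R < t * b" using t assms by (intro power2_less_imp_less[of "q * R"]) auto
  then have Y1: "\<bar>Y\<bar> < 1" using q R t assms by (simp add: Y_def)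
  have "X + Y = a\<^sup>2 * (b + q) / (t * R * b)"
  proof -
    have "X + Y = ((a\<^sup>2 - b * q) * b + q * R\<^sup>2) / (t * R * b)"
      unfolding Xeq Y_def using t R(1) assms by (simp add: field_simps power2_eq_square)
    also have "(a\<^sup>2 - b * q) * b + q * R\<^sup>2 = a\<^sup>2 * (b + q)" unfolding R s_def by algebra
    finally show ?thesis .
  qed
  moreover have "1 + X * Y = a\<^sup>2 * (b + q) / (t\<^sup>2 * b)"
  proof -
    have "1 + X * Y = (t\<^sup>2 * b + (a\<^sup>2 - b * q) * q) / (t\<^sup>2 * b)"
      unfolding Xeq Y_def using t R(1) assms by (simp add: field_simps power2_eq_square)
    also have "t\<^sup>2 * b + (a\<^sup>2 - b * q) * q = a\<^sup>2 * (b + q)" using q2 by algebra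
    finally show ?thesis .
  qed
  ultimately have "(X + Y) / (1 + X * Y) = t / R"
    using t R(1) assms q by (simp add: power2_eq_square)
  then have "artanh X = artanh (t / R) - artanh Y" using artanh_add[OF X1 Y1] by simp
  moreover have "(2 * a * sin \<theta> - 2 * b * cos \<theta>) / s = (2 * a * q - 2 * a * b) / (t * s)"
    using t s by (simp add: \<theta> field_simps)
  ultimately show ?thesis
    unfolding angle_integral_def q_def[symmetric] s_def[symmetric] R_def[symmetric] \<theta>_def[symmetric] X_def[symmetric] Y_def[symmetric]
    by simp
qed

lemma half_pdf_below:
  "0 < a \<Longrightarrow> 0 < b \<Longrightarrow> t < a \<Longrightarrow> half_pdf a b t =
    2 * b / (a\<^sup>2 + b\<^sup>2) - 2 * a * b / (a\<^sup>2 + b\<^sup>2) powr (3/2) * artanh (a / sqrt (a\<^sup>2 + b\<^sup>2))"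
  by (simp add: half_pdf_def wall_angle_below angle_integral_def)

lemma half_pdf_above:
  "0 < a \<Longrightarrow> 0 < b \<Longrightarrow> a < t \<Longrightarrow> t < sqrt (a\<^sup>2 + b\<^sup>2) \<Longrightarrow> half_pdf a b t =
    a * (b - sqrt (t\<^sup>2 - a\<^sup>2)) / (t * (b + sqrt (t\<^sup>2 - a\<^sup>2)) * sqrt (t\<^sup>2 - a\<^sup>2))
    - ((2 * a * sqrt (t\<^sup>2 - a\<^sup>2) - 2 * a * b) / (t * (a\<^sup>2 + b\<^sup>2))
    + 2 * a * b / (a\<^sup>2 + b\<^sup>2) powr (3/2) * (artanh (t / sqrt (a\<^sup>2 + b\<^sup>2))
       - artanh (sqrt (t\<^sup>2 - a\<^sup>2) * sqrt (a\<^sup>2 + b\<^sup>2) / (t * b))))"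
  by (simp add: half_pdf_def angle_integral_wall_angle)

text \<open>
  The three cases of the density correspond to \<open>t\<close> exceeding neither, one or both of the sides; each
  excess exchanges the constant form of one \<open>half_pdf\<close> for the one with a singularity.
\<close>
lemma bounce_pdf_eq:
  assumes "0 < a" "a \<le> b" "0 < t" "t < sqrt (a\<^sup>2 + b\<^sup>2)" "t \<noteq> a" "t \<noteq> b"
  shows "bounce_pdf a b t = 2 / pi * (half_pdf a b t + half_pdf b a t)"
proof -
  have b: "0 < b" "b < sqrt (a\<^sup>2 + b\<^sup>2)" using assms by (auto intro!: real_less_rsqrt)
  have c: "b\<^sup>2 + a\<^sup>2 = a\<^sup>2 + b\<^sup>2" by simp
  have s: "0 < a\<^sup>2 + b\<^sup>2" using assms by (simp add: sum_power2_gt_zero_iff)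
  define K where "K = 2 * a * b / (a\<^sup>2 + b\<^sup>2) powr (3/2)"
  have K: "2 * a * b * z / (a\<^sup>2 + b\<^sup>2) powr (3/2) = K * z" for z by (simp add: K_def)
  have K': "2 * b * a / (a\<^sup>2 + b\<^sup>2) powr (3/2) = K" by (simp add: K_def)
  consider "t < a" | "a < t" "t < b" | "b < t" using assms by linarith
  then show ?thesis
  proof cases
    case 1
    then show ?thesis using assms b
      unfolding bounce_pdf_def half_pdf_below[OF assms(1) b(1) 1] 
        half_pdf_below[OF b(1) assms(1) less_le_trans[OF 1 assms(2)]] c K K' K_def[symmetric]
      by (simp add: algebra_simps add_divide_distrib)
  next
    case 2
    have "2 * a * t / (t * (a\<^sup>2 + b\<^sup>2)) = 2 * a / (a\<^sup>2 + b\<^sup>2)" using assms by simp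
    then show ?thesis using assms b 2
      unfolding bounce_pdf_def half_pdf_above[OF assms(1) b(1) 2(1) assms(4)]
        half_pdf_below[OF b(1) assms(1) 2(2)] c K K' K_def[symmetric]
      by (simp add: algebra_simps add_divide_distrib diff_divide_distrib)
  next
    case 3
    have 4: "a < t" "t < sqrt (b\<^sup>2 + a\<^sup>2)" using 3 assms by (auto simp: c)
    show ?thesis using assms b 3 4
      unfolding bounce_pdf_def half_pdf_above[OF assms(1) b(1) 4(1) assms(4)]
        half_pdf_above[OF b(1) assms(1) 3 4(2)] c K K' K_def[symmetric]
      by (simp add: algebra_simps add_divide_distrib diff_divide_distrib)
  qed
qed

lemma angle_integral_reflect: 
  assumes "0 < a" "0 < b" "0 \<le> \<theta>" "\<theta> \<le> pi / 2"
  shows "angle_integral a b (pi / 2 - \<theta>) = - angle_integral b a \<theta>"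
proof -
  have sc: "sin (pi / 2 - \<theta>) = cos \<theta>" "cos (pi / 2 - \<theta>) = sin \<theta>"
    by (simp_all add: sin_diff cos_diff)
  define u where "u = (b * cos \<theta> - a * sin \<theta>) / sqrt (b\<^sup>2 + a\<^sup>2)"
  have "artanh (- u) = - artanh u"
    using artanh_argument_bounds(2)[of b a \<theta>] assms by (intro artanh_minus_real) (auto simp: u_def)
  moreover have "(a * sin \<theta> - b * cos \<theta>) / sqrt (a\<^sup>2 + b\<^sup>2) = - u"
    unfolding u_def minus_divide_left by (simp add: add.commute)
  moreover have "b\<^sup>2 + a\<^sup>2 = a\<^sup>2 + b\<^sup>2" "2 * b * a = 2 * a * b" by simp_all
  ultimately show ?thesis unfolding angle_integral_def sc u_def[symmetric]
    by (simp only:) (simp add: diff_divide_distrib)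
qed

text \<open>
  The terms with \<open>angle_integral\<close> combine to the integral of a nonnegative function between the two critical directions.
\<close>
lemma bounce_pdf_nonneg:
  assumes "0 < a" "a \<le> b" "0 < t" "t < sqrt (a\<^sup>2 + b\<^sup>2)" "t \<noteq> a" "t \<noteq> b"
  shows "0 \<le> bounce_pdf a b t"
proof -
  have b: "0 < b" using assms by simp
  have edge: "0 \<le> (if t < c then 0 else c * (d - sqrt (t\<^sup>2 - c\<^sup>2)) / (t * (d + sqrt (t\<^sup>2 - c\<^sup>2)) * sqrt (t\<^sup>2 - c\<^sup>2)))"
    if "0 < c" "0 < d" "t < sqrt (c\<^sup>2 + d\<^sup>2)" "t \<noteq> c" for c d
  proof (cases "t < c")
    case False
    then have "0 < sqrt (t\<^sup>2 - c\<^sup>2)" "sqrt (t\<^sup>2 - c\<^sup>2) < d" using sqrt_diff_less[of c d t] that by auto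
    then show ?thesis using that assms(3) False by (auto intro!: divide_nonneg_pos mult_pos_pos add_pos_pos)
  qed simp
  have "angle_integral a b (wall_angle a t) \<le> angle_integral a b (pi / 2 - wall_angle b t)"
    using assms(1) b wall_angle_bounds(1)[OF assms(1)] wall_angle_le[OF assms(1) b] assms(4)
      wall_angle_bounds(1)[OF b, of t]
    by (intro angle_integral_mono) simp_all
  also have "\<dots> = - angle_integral b a (wall_angle b t)"
    using wall_angle_bounds(1,2)[OF b, of t] assms(1) b by (intro angle_integral_reflect) simp_all
  finally have le: "angle_integral a b (wall_angle a t) \<le> - angle_integral b a (wall_angle b t)" .
  have t': "t < sqrt (b\<^sup>2 + a\<^sup>2)" using assms(4) by (simp add: add.commute)
  have "0 \<le> half_pdf a b t + half_pdf b a t"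
    unfolding half_pdf_def
    using le edge[OF assms(1) b assms(4,5)] edge[OF b assms(1) t' assms(6)] by linarith
  then show ?thesis using bounce_pdf_eq[OF assms] by simp
qed

lemma wall_angle_gt_iff:
  assumes "0 < a" "0 \<le> \<theta>" "\<theta> < pi / 2"
  shows "\<theta> < wall_angle a x \<longleftrightarrow> a / cos \<theta> < max a x"
proof -
  have c: "0 < cos \<theta>" using assms by (intro cos_gt_zero_pi) auto
  have "\<theta> < wall_angle a x \<longleftrightarrow> cos (wall_angle a x) < cos \<theta>"
    using wall_angle_bounds[OF assms(1), of x] assms by (intro cos_mono_less_eq[symmetric]) auto
  moreover define m where "m = max a x"
  moreover have "0 < m" using assms by (simp add: m_def)
  ultimately show ?thesis
    using wall_angle_bounds(3)[OF assms(1), of x, folded m_def] c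
    by (simp add: pos_divide_less_eq mult.commute)
qed

text \<open>
  The directions for which one of the periods is below \<open>x\<close>, so that all gaps are, and the remaining
  ones, for which \<open>x\<close> lies in the range of uniformly distributed gaps.
\<close>
lemma gap_cdf_quadrant:
  fixes a b x \<theta> :: real
  assumes "0 < a" "0 < b" "0 \<le> x" "x \<le> sqrt (a\<^sup>2 + b\<^sup>2)" "0 < \<theta>" "\<theta> < pi / 2"
  shows "\<theta> < wall_angle a x \<Longrightarrow> gap_cdf (a / cos \<theta>) (b / sin \<theta>) x = 1"
    and "pi / 2 - wall_angle b x < \<theta> \<Longrightarrow> gap_cdf (a / cos \<theta>) (b / sin \<theta>) x = 1"
    and "wall_angle a x < \<theta> \<Longrightarrow> \<theta> < pi / 2 - wall_angle b x \<Longrightarrow> gap_cdf (a / cos \<theta>) (b / sin \<theta>) x =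
       x * (2 * cos \<theta> * sin \<theta> / (a * sin \<theta> + b * cos \<theta>))"
proof -
  have c: "0 < cos \<theta>" "cos \<theta> < 1" "0 < sin \<theta>" "sin \<theta> < 1"
    using assms cos_monotone_0_pi[of 0 \<theta>] sin_monotone_2pi[of \<theta> "pi/2"]
    by (auto intro!: cos_gt_zero_pi sin_gt_zero)
  have ac: "a < a / cos \<theta>" and bs: "b < b / sin \<theta>" using c assms by (auto simp: field_simps)
  have A: "\<theta> < wall_angle a x \<longleftrightarrow> a / cos \<theta> < x"
    using wall_angle_gt_iff[of a \<theta> x] assms ac by auto
  have "pi / 2 - \<theta> < wall_angle b x \<longleftrightarrow> b / cos (pi / 2 - \<theta>) < max b x"
    using assms by (intro wall_angle_gt_iff) auto
  then have B: "pi / 2 - wall_angle b x < \<theta> \<longleftrightarrow> b / sin \<theta> < x"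
    using bs by (auto simp: cos_diff)
  show "gap_cdf (a / cos \<theta>) (b / sin \<theta>) x = 1" if "\<theta> < wall_angle a x"
    using that A assms by (auto simp: gap_cdf_def)
  show "gap_cdf (a / cos \<theta>) (b / sin \<theta>) x = 1" if "pi / 2 - wall_angle b x < \<theta>"
    using that B assms by (auto simp: gap_cdf_def)
  show "gap_cdf (a / cos \<theta>) (b / sin \<theta>) x = x * (2 * cos \<theta> * sin \<theta> / (a * sin \<theta> + b * cos \<theta>))" 
    if "wall_angle a x < \<theta>" "\<theta> < pi / 2 - wall_angle b x"
  proof -
    have ne: "x \<noteq> a / cos \<theta>"
    proof
      assume "x = a / cos \<theta>"
      then have "max a x = x" "a / x = cos \<theta>" using ac c assms by auto
      then have "wall_angle a x = \<theta>" using assms by (simp add: wall_angle_def arccos_cos)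
      then show False using that by simp
    qed
    have ne': "x \<noteq> b / sin \<theta>"
    proof
      assume "x = b / sin \<theta>"
      then have "max b x = x" "b / x = cos (pi / 2 - \<theta>)" using bs c assms by (auto simp: cos_diff)
      then have "wall_angle b x = pi / 2 - \<theta>" using assms by (simp only: wall_angle_def) (rule arccos_cos, auto)
      then show False using that by simp
    qed
    have "x < a / cos \<theta>" "x < b / sin \<theta>" using A B that ne ne' by linarith+
    moreover have "a / cos \<theta> + b / sin \<theta> = (a * sin \<theta> + b * cos \<theta>) / (cos \<theta> * sin \<theta>)"
      using c by (simp add: field_simps)
    ultimately show ?thesis using assms by (simp add: gap_cdf_def)
  qed
qed

lemma has_integral_gap_cdf_below_diagonal:
  assumes "0 < a" "0 < b" "0 \<le> x" "x \<le> sqrt (a\<^sup>2 + b\<^sup>2)"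
  shows "((\<lambda>\<theta>. gap_cdf (a / cos \<theta>) (b / sin \<theta>) x) has_integral half_cdf a b x + half_cdf b a x) {0..pi / 2}"
proof -
  let ?g = "\<lambda>\<theta>. gap_cdf (a / cos \<theta>) (b / sin \<theta>) x"
  define t where "t = wall_angle a x"
  define u where "u = pi / 2 - wall_angle b x"
  have tu: "0 \<le> t" "t \<le> u" "u \<le> pi / 2"
    using wall_angle_bounds[OF assms(1), of x] wall_angle_bounds[OF assms(2), of x] wall_angle_le[OF assms(1,2,4)]
    by (auto simp: t_def u_def)
  note gq = gap_cdf_quadrant[OF assms, folded t_def, folded u_def]
  have 1: "(?g has_integral t) {0..t}"
  proof (rule has_integral_spike_finite[where S = "{0, t}" and f = "\<lambda>_. 1"])
    show "((\<lambda>_. 1) has_integral t) {0..t}" using has_integral_const_real[of "1::real" 0 t] tu by simp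
  qed (use gq(1) tu in auto)
  have 3: "(?g has_integral pi / 2 - u) {u..pi / 2}"
  proof (rule has_integral_spike_finite[where S = "{u, pi / 2}" and f = "\<lambda>_. 1"])
    show "((\<lambda>_. 1) has_integral pi / 2 - u) {u..pi / 2}" using has_integral_const_real[of "1::real" u "pi/2"] tu by simp
  qed (use gq(2) tu in auto)
  have 2: "(?g has_integral x * (angle_integral a b u - angle_integral a b t)) {t..u}"
  proof (rule has_integral_spike_finite[where S = "{t, u}" and f = "\<lambda>\<theta>. x * (2 * cos \<theta> * sin \<theta> / (a * sin \<theta> + b * cos \<theta>))"])
    have "((\<lambda>\<theta>. 2 * cos \<theta> * sin \<theta> / (a * sin \<theta> + b * cos \<theta>)) has_integral angle_integral a b u - angle_integral a b t) {t..u}"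
      using angle_integral_deriv[OF assms(1,2)] tu
      by (intro fundamental_theorem_of_calculus has_real_derivative_iff_has_vector_derivative[THEN iffD1])
         (auto intro: has_field_derivative_at_within)
    then show "((\<lambda>\<theta>. x * (2 * cos \<theta> * sin \<theta> / (a * sin \<theta> + b * cos \<theta>))) has_integral x * (angle_integral a b u - angle_integral a b t)) {t..u}"
      by (rule has_integral_mult_right)
  qed (use gq(3) tu in auto)
  have "(?g has_integral t + x * (angle_integral a b u - angle_integral a b t) + (pi / 2 - u)) {0..pi/2}"
    using has_integral_combine[OF _ _ has_integral_combine[OF _ _ 1 2] 3] tu by auto
  moreover have "angle_integral a b u = - angle_integral b a (wall_angle b x)"
    unfolding u_def using wall_angle_bounds[OF assms(2), of x] assms by (intro angle_integral_reflect) auto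
  ultimately show ?thesis
    by (simp add: half_cdf_def t_def u_def algebra_simps)
qed

text \<open>At the diagonal the two critical directions coincide with that of the diagonal.\<close>
lemma half_cdf_diagonal:
  assumes "0 < a" "0 < b"
  defines "d \<equiv> sqrt (a\<^sup>2 + b\<^sup>2)"
  shows "half_cdf a b d + half_cdf b a d = pi / 2"
proof -
  have d: "a \<le> d" "b \<le> d" "0 < d" "d\<^sup>2 = a\<^sup>2 + b\<^sup>2"
    using assms(1,2) by (auto intro: real_le_rsqrt simp: d_def add_pos_pos)
  have m: "max a d = d" "max b d = d" using d by simp_all
  note A = wall_angle_bounds[OF assms(1), of d, unfolded m] and B = wall_angle_bounds[OF assms(2), of d, unfolded m]
  have "sin (wall_angle a d) = b / d" using assms(2) unfolding A(4) d(4) by simp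
  moreover have "sin (pi / 2 - wall_angle b d) = b / d" by (simp add: sin_diff B(3))
  ultimately have "sin (wall_angle a d) = sin (pi / 2 - wall_angle b d)" by simp
  then have eq: "wall_angle a d = pi / 2 - wall_angle b d"
    using A(1,2) B(1,2) by - (rule sin_inj_pi[rotated 4]; linarith)
  moreover have "angle_integral a b (pi / 2 - wall_angle b d) = - angle_integral b a (wall_angle b d)"
    using B(1,2) assms(1,2) by (intro angle_integral_reflect) simp_all
  ultimately show ?thesis by (simp add: half_cdf_def)
qed

text \<open>
  Beyond the diagonal one of the periods is always at most \<open>x\<close>, since \<open>a / cos \<theta>\<close> and \<open>b / sin \<theta>\<close> cannot
  both exceed \<open>sqrt (a\<^sup>2 + b\<^sup>2)\<close>.
\<close>
lemma has_integral_gap_cdf_quadrant: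
  assumes "0 < a" "0 < b"
  shows "((\<lambda>\<theta>. gap_cdf (a / \<bar>cos \<theta>\<bar>) (b / \<bar>sin \<theta>\<bar>) x) has_integral pi / 2 * bounce_cdf a b x) {0..pi / 2}"
proof -
  have "((\<lambda>\<theta>. gap_cdf (a / cos \<theta>) (b / sin \<theta>) x) has_integral pi / 2 * bounce_cdf a b x) {0..pi / 2}"
  proof -
    consider "x < 0" | "0 \<le> x" "x < sqrt (a\<^sup>2 + b\<^sup>2)" | "sqrt (a\<^sup>2 + b\<^sup>2) \<le> x" by linarith
    then show ?thesis
    proof cases
      case 1
      then show ?thesis by (simp add: gap_cdf_def bounce_cdf_def)
    next
      case 2
      then have "pi / 2 * bounce_cdf a b x = half_cdf a b x + half_cdf b a x"
        by (simp add: bounce_cdf_def del: distrib_left_numeral)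
      then show ?thesis using 2 has_integral_gap_cdf_below_diagonal[OF assms, of x] by (simp only: less_imp_le)
    next
      case 3
      have pos: "0 < sqrt (a\<^sup>2 + b\<^sup>2)" using assms by (simp add: add_pos_pos)
      have "gap_cdf (a / cos \<theta>) (b / sin \<theta>) x = 1" if "0 < \<theta>" "\<theta> < pi / 2" for \<theta>
      proof -
        have c: "0 < cos \<theta>" "0 < sin \<theta>" using that by (auto intro!: cos_gt_zero_pi sin_gt_zero)
        have "min (a / cos \<theta>) (b / sin \<theta>) \<le> sqrt (a\<^sup>2 + b\<^sup>2)"
        proof (rule ccontr)
          assume "\<not> ?thesis"
          then have "sqrt (a\<^sup>2 + b\<^sup>2) * cos \<theta> < a" "sqrt (a\<^sup>2 + b\<^sup>2) * sin \<theta> < b"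
            using c by (auto simp: min_le_iff_disj not_le pos_less_divide_eq)
          then have "(sqrt (a\<^sup>2 + b\<^sup>2) * cos \<theta>)\<^sup>2 + (sqrt (a\<^sup>2 + b\<^sup>2) * sin \<theta>)\<^sup>2 < a\<^sup>2 + b\<^sup>2"
            using c pos by (intro add_strict_mono power_strict_mono) auto
          then have "(a\<^sup>2 + b\<^sup>2) * ((sin \<theta>)\<^sup>2 + (cos \<theta>)\<^sup>2) < a\<^sup>2 + b\<^sup>2"
            by (simp only: power_mult_distrib) (simp add: algebra_simps del: sin_cos_squared_add sin_cos_squared_add2)
          then show False by simp
        qed
        moreover have "\<not> x < 0" using 3 pos by linarith
        ultimately show ?thesis using 3 by (simp add: gap_cdf_def del: min_less_iff_conj min_le_iff_disj)
      qed
      then have "((\<lambda>\<theta>. gap_cdf (a / cos \<theta>) (b / sin \<theta>) x) has_integral pi / 2) {0..pi / 2}"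
        using has_integral_const_real[of "1::real" 0 "pi/2"]
        by - (rule has_integral_spike_finite[where S = "{0, pi / 2}" and f = "\<lambda>_. 1"], auto)
      moreover have "\<not> x < 0" using 3 pos by linarith
      ultimately show ?thesis using 3 by (simp add: bounce_cdf_def)
    qed
  qed
  then show ?thesis
    by (rule has_integral_eq[rotated]) (auto simp: cos_ge_zero sin_ge_zero)
qed

lemma has_integral_gap_cdf_circle:
  assumes "0 < a" "0 < b"
  shows "((\<lambda>\<theta>. gap_cdf (a / \<bar>cos \<theta>\<bar>) (b / \<bar>sin \<theta>\<bar>) x) has_integral 2 * pi * bounce_cdf a b x) {0..2 * pi}"
proof -
  let ?g = "\<lambda>\<theta>. gap_cdf (a / \<bar>cos \<theta>\<bar>) (b / \<bar>sin \<theta>\<bar>) x"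
  note 1 = has_integral_gap_cdf_quadrant[OF assms, of x]
  have "((\<lambda>\<theta>. ?g (- 1 * \<theta> + pi)) has_integral pi / 2 * bounce_cdf a b x) {pi / 2..pi}"
    using has_integral_affinity[of ?g _ 0 "pi/2" "-1" pi] 1
    by (simp add: image_affinity_atLeastAtMost)
  then have "(?g has_integral pi / 2 * bounce_cdf a b x) {pi / 2..pi}"
    by (simp add: cos_diff sin_diff)
  from has_integral_combine[OF _ _ 1 this]
  have 2: "(?g has_integral pi * bounce_cdf a b x) {0..pi}"
    by (simp add: field_simps)
  have "((\<lambda>\<theta>. ?g (1 * \<theta> + - pi)) has_integral pi * bounce_cdf a b x) {pi..2 * pi}"
    using has_integral_affinity[of ?g _ 0 pi 1 "- pi"] 2
    by (simp add: image_affinity_atLeastAtMost)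
  then have "(?g has_integral pi * bounce_cdf a b x) {pi..2 * pi}"
    by (simp add: cos_diff sin_diff)
  from has_integral_combine[OF _ _ 2 this] show ?thesis
    by (simp add: algebra_simps)
qed

section \<open>The limit law\<close>

lemma continuous_on_wall_angle:
  assumes "0 < a"
  shows "continuous_on UNIV (wall_angle a)"
  unfolding wall_angle_def[abs_def]
proof (intro continuous_intros ballI)
  fix x
  have "0 < a / max a x" "a / max a x \<le> 1" using assms by (auto simp: max_def)
  then show "- 1 \<le> a / max a x \<and> a / max a x \<le> 1" by linarith
qed (use assms in \<open>auto simp: max_def\<close>)

lemma continuous_on_half_cdf:
  assumes "0 < a" "0 < b"
  shows "continuous_on UNIV (half_cdf a b)"
proof -
  have "continuous_on {0..pi/2} (angle_integral a b)"
    using angle_integral_deriv[OF assms] by (intro continuous_at_imp_continuous_on ballI DERIV_isCont) auto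
  moreover have "wall_angle a x \<in> {0..pi / 2}" for x
    using wall_angle_bounds(1,2)[OF assms(1), of x] by (simp only: atLeastAtMost_iff less_imp_le)
  ultimately have "continuous_on UNIV (\<lambda>x. angle_integral a b (wall_angle a x))"
    by (intro continuous_on_compose2[OF _ continuous_on_wall_angle[OF assms(1)]]) blast+
  then show ?thesis unfolding half_cdf_def[abs_def]
    using continuous_on_wall_angle[OF assms(1)] by (intro continuous_intros)
qed

text \<open>
  The density has a singularity of inverse square root type at the side lengths, but the distribution
  function is continuous there, which is all that the fundamental theorem of calculus needs at
  finitely many points.
\<close>
lemma has_integral_bounce_pdf:
  assumes "0 < a" "a \<le> b" "0 \<le> x"
  shows "(bounce_pdf a b has_integral bounce_cdf a b x) {0..x}"
proof -
  define d where "d = sqrt (a\<^sup>2 + b\<^sup>2)"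
  have b: "0 < b" using assms by simp
  have d: "0 < d" "a < d" "b < d" using assms b by (auto intro: real_less_rsqrt simp: d_def add_pos_pos)
  define G where "G = (\<lambda>x. 2 / pi * (half_cdf a b x + half_cdf b a x))"
  have G0: "G 0 = 0" using assms b by (simp add: G_def half_cdf_def wall_angle_below)
  have Gd: "G d = 1" using half_cdf_diagonal[OF assms(1) b] by (simp add: G_def d_def)
  have G: "(bounce_pdf a b has_integral G x) {0..x}" if "0 \<le> x" "x \<le> d" for x
  proof -
    have "(bounce_pdf a b has_integral (G x - G 0)) {0..x}"
    proof (rule fundamental_theorem_of_calculus_interior_strong[of "{a, b}"])
      fix t assume t: "t \<in> {0<..<x} - {a, b}"
      have "(G has_real_derivative 2 / pi * (half_pdf a b t + half_pdf b a t)) (at t)"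
        unfolding G_def using t assms b by (intro DERIV_cmult DERIV_add half_cdf_deriv) auto
      also have "2 / pi * (half_pdf a b t + half_pdf b a t) = bounce_pdf a b t"
        using bounce_pdf_eq[OF assms(1,2), of t] t that by (simp add: d_def)
      finally show "(G has_vector_derivative bounce_pdf a b t) (at t)"
        by (simp add: has_real_derivative_iff_has_vector_derivative)
    next
      show "continuous_on {0..x} G" unfolding G_def
        using continuous_on_half_cdf[OF assms(1) b] continuous_on_half_cdf[OF b assms(1)]
        by (intro continuous_intros) (auto intro: continuous_on_subset)
    qed (use that in auto)
    then show ?thesis by (simp add: G0)
  qed
  show ?thesis
  proof (cases "x < d")
    case True
    then show ?thesis using G[of x] assms by (simp add: bounce_cdf_def G_def d_def)
  next
    case False
    have "(bounce_pdf a b has_integral 0) {d..x}"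
      using d by - (rule has_integral_spike_finite[where S = "{d}" and f = "\<lambda>_. 0"], auto simp: bounce_pdf_def d_def)
    from has_integral_combine[OF _ _ G this]
    have "(bounce_pdf a b has_integral 1) {0..x}" using Gd False d by simp
    then show ?thesis using False assms d by (simp add: bounce_cdf_def d_def)
  qed
qed

definition bounce_law :: "real \<Rightarrow> real \<Rightarrow> real measure" where
  "bounce_law a b = density lborel (\<lambda>t. ennreal (bounce_pdf a b t))"

lemma borel_measurable_bounce_pdf [measurable]: "bounce_pdf a b \<in> borel_measurable borel"
  unfolding bounce_pdf_def[abs_def] artanh_def by measurable

text \<open>
  The law is concentrated between 0 and the diagonal. Stating the measure for any \<open>A\<close> that agrees
  with \<open>{0..x}\<close> in this range covers half-lines and the whole line.
\<close>
lemma emeasure_bounce_law: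
  assumes "0 < a" "a \<le> b" "{0..x} \<subseteq> A" "A \<inter> {0<..<sqrt (a\<^sup>2 + b\<^sup>2)} \<subseteq> {0..x}" "0 \<le> x" "A \<in> sets borel"
  shows "emeasure (bounce_law a b) A = ennreal (bounce_cdf a b x)"
proof -
  have b: "0 < b" "a < sqrt (a\<^sup>2 + b\<^sup>2)" "b < sqrt (a\<^sup>2 + b\<^sup>2)"
    using assms(1,2) by (auto intro: real_less_rsqrt)
  have zero: "bounce_pdf a b t = 0" if "t \<notin> {0<..<sqrt (a\<^sup>2 + b\<^sup>2)}" for t
    using that assms(1,2) b by (auto simp: bounce_pdf_def)
  \<comment> \<open>a modification on a null set which is nonnegative everywhere\<close>
  define f where "f t = (if t \<in> {0, a, b} then 0 else bounce_pdf a b t)" for t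
  have f: "0 \<le> f t" for t
    using bounce_pdf_nonneg[OF assms(1,2), of t] zero[of t]
    by (cases "t \<in> {0<..<sqrt (a\<^sup>2 + b\<^sup>2)}") (auto simp: f_def)
  have "emeasure (bounce_law a b) A = (\<integral>\<^sup>+ t. ennreal (bounce_pdf a b t) * indicator A t \<partial>lborel)"
    unfolding bounce_law_def using assms(6) by (simp add: emeasure_density)
  also have "\<dots> = (\<integral>\<^sup>+ t. ennreal (f t) * indicator {0..x} t \<partial>lborel)"
  proof (rule nn_integral_cong_AE)
    have "AE t in lborel. t \<notin> {0, a, b}"
      by (intro AE_not_in finite_imp_null_set_lborel) auto
    then show "AE t in lborel. ennreal (bounce_pdf a b t) * indicator A t = ennreal (f t) * indicator {0..x} t"
    proof eventually_elim
      case (elim t)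
      have "t \<in> A \<longleftrightarrow> t \<in> {0..x}" if "t \<in> {0<..<sqrt (a\<^sup>2 + b\<^sup>2)}"
        using assms(3,4) that by (auto dest: subsetD)
      then show ?case using elim zero[of t]
        by (cases "t \<in> {0<..<sqrt (a\<^sup>2 + b\<^sup>2)}") (auto simp: f_def indicator_def)
    qed
  qed
  also have "\<dots> = ennreal (bounce_cdf a b x)"
  proof (rule nn_integral_has_integral_lebesgue')
    show "(f has_integral bounce_cdf a b x) {0..x}"
      by (rule has_integral_spike_finite[OF _ _ has_integral_bounce_pdf[OF assms(1,2,5)], of "{0,a,b}"]) (auto simp: f_def)
  qed (rule f)
  finally show ?thesis .
qed

lemma real_distribution_bounce_law:
  assumes "0 < a" "a \<le> b"
  shows "real_distribution (bounce_law a b)"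
proof -
  have "0 < sqrt (a\<^sup>2 + b\<^sup>2)" using assms by (simp add: add_pos_pos)
  then have "emeasure (bounce_law a b) UNIV = 1"
    using emeasure_bounce_law[OF assms, of "sqrt (a\<^sup>2 + b\<^sup>2)" UNIV]
    by (auto simp: bounce_cdf_def less_imp_le subset_eq)
  moreover have "space (bounce_law a b) = UNIV" "sets (bounce_law a b) = sets borel" by (auto simp: bounce_law_def)
  ultimately show ?thesis by (intro real_distribution.intro real_distribution_axioms.intro prob_spaceI) auto
qed

lemma cdf_bounce_law:
  assumes "0 < a" "a \<le> b"
  shows "cdf (bounce_law a b) x = bounce_cdf a b x"
proof -
  have nonneg: "0 \<le> bounce_cdf a b x" if "0 \<le> x" for x
  proof -
    have "0 \<le> pi / 2 * bounce_cdf a b x"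
      using assms by (intro has_integral_nonneg[OF has_integral_gap_cdf_quadrant[of a b x]])
        (auto simp: gap_cdf_def)
    then show ?thesis using pi_gt_zero by (simp add: zero_le_mult_iff del: pi_gt_zero)
  qed
  have "emeasure (bounce_law a b) {..x} = ennreal (bounce_cdf a b x)"
  proof (cases "0 \<le> x")
    case True
    then show ?thesis using assms by (intro emeasure_bounce_law) auto
  next
    case False
    have "emeasure (bounce_law a b) {..x} \<le> emeasure (bounce_law a b) {..0}"
      using False by (intro emeasure_mono) (auto simp: bounce_law_def)
    also have "\<dots> = ennreal (bounce_cdf a b 0)" using assms by (intro emeasure_bounce_law) auto
    also have "bounce_cdf a b 0 = 0"
      using assms by (simp add: bounce_cdf_def half_cdf_def wall_angle_below sum_power2_gt_zero_iff)
    finally show ?thesis using False by (simp add: bounce_cdf_def)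
  qed
  then show ?thesis using nonneg[of x] 
    by (cases "0 \<le> x") (auto simp: cdf_def measure_def bounce_cdf_def)
qed

section \<open>Measurability and the uniform direction\<close>

text \<open>
  The measure space of initial states without its law: only the sigma-algebra matters for
  measurability.
\<close>
definition phase_algebra :: "real \<Rightarrow> real \<Rightarrow> ((real \<times> real) \<times> (real \<times> real)) measure" where
  "phase_algebra a b = restrict_space borel (rectangle a b) \<Otimes>\<^sub>M restrict_space borel (sphere 0 1)"

lemma space_phase_algebra: "space (phase_algebra a b) = phase_space a b"
  by (auto simp: phase_algebra_def phase_space_def space_pair_measure space_restrict_space)

lemma fst_phase_measurable: "fst \<in> borel_measurable (phase_algebra a b)"
  and snd_phase_measurable: "snd \<in> borel_measurable (phase_algebra a b)"
  unfolding phase_algebra_def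
  using measurable_restrict_space2_iff[THEN iffD1, THEN conjunct1, OF measurable_fst]
    measurable_restrict_space2_iff[THEN iffD1, THEN conjunct1, OF measurable_snd] by blast+

lemma flight_time_measurable: "flight_time a b \<in> borel_measurable (phase_algebra a b)"
proof (rule borel_measurableI_ge)
  fix t :: real
  note [measurable] = fst_phase_measurable[of a b] snd_phase_measurable[of a b]
  have [measurable]: "rectangle a b \<in> sets borel" using rectangle_convex_compact_closed(3) by (rule borel_closed)
  show "{s \<in> space (phase_algebra a b). t \<le> flight_time a b s} \<in> sets (phase_algebra a b)"
  proof (cases "0 \<le> t")
    case True
    then have "{s \<in> space (phase_algebra a b). t \<le> flight_time a b s} =
        {s \<in> space (phase_algebra a b). fst s + t *\<^sub>R snd s \<in> rectangle a b}"
      using flight_time_ge_iff(1)[OF _ _ True] by (auto simp: space_phase_algebra phase_space_def)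
    also have "\<dots> \<in> sets (phase_algebra a b)" by measurable
    finally show ?thesis .
  next
    case False
    then have "{s \<in> space (phase_algebra a b). t \<le> flight_time a b s} = space (phase_algebra a b)"
      using flight_time_ge_iff(2)[OF _ _ order_refl] by (fastforce simp: space_phase_algebra phase_space_def)
    then show ?thesis by simp
  qed
qed

lemma bounce_measurable: "bounce a b \<in> measurable (phase_algebra a b) (phase_algebra a b)"
proof -
  note [measurable] = fst_phase_measurable[of a b] snd_phase_measurable[of a b] flight_time_measurable[of a b]
  let ?q = "\<lambda>s. fst s + flight_time a b s *\<^sub>R snd s"
  have f: "(\<lambda>s. fst (bounce a b s)) \<in> borel_measurable (phase_algebra a b)"
    by (simp add: bounce_def Let_def split_beta) measurable
  have [measurable]: "?q \<in> borel_measurable (phase_algebra a b)" by measurable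
  have c: "fst \<in> borel_measurable (borel :: (real \<times> real) measure)" "snd \<in> borel_measurable (borel :: (real \<times> real) measure)"
    by (auto intro!: borel_measurable_continuous_onI continuous_intros)
  have [measurable]: "(\<lambda>s. fst (?q s)) \<in> borel_measurable (phase_algebra a b)" 
    "(\<lambda>s. snd (?q s)) \<in> borel_measurable (phase_algebra a b)" 
    "(\<lambda>s. fst (snd s)) \<in> borel_measurable (phase_algebra a b)"
    "(\<lambda>s. snd (snd s)) \<in> borel_measurable (phase_algebra a b)"
    using c by (auto intro: measurable_compose[rotated])
  have "(\<lambda>s. snd (bounce a b s)) = (\<lambda>s.
     (if fst (?q s) = 0 \<and> fst (snd s) < 0 \<or> fst (?q s) = a \<and> fst (snd s) > 0 then - fst (snd s) else fst (snd s),
      if snd (?q s) = 0 \<and> snd (snd s) < 0 \<or> snd (?q s) = b \<and> snd (snd s) > 0 then - snd (snd s) else snd (snd s)))"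
    by (simp add: bounce_def Let_def split_beta reflect_def fun_eq_iff)
  also have "\<dots> \<in> borel_measurable (phase_algebra a b)"
    by (intro borel_measurable_Pair measurable_If) measurable
  finally have g: "(\<lambda>s. snd (bounce a b s)) \<in> borel_measurable (phase_algebra a b)" .
  have "fst (bounce a b s) \<in> rectangle a b \<and> snd (bounce a b s) \<in> sphere 0 1" if "s \<in> space (phase_algebra a b)" for s
    using bounce_in_phase_space[of s a b] that unfolding space_phase_algebra
    by (cases "bounce a b s") (simp add: phase_space_def)
  then have "(\<lambda>s. (fst (bounce a b s), snd (bounce a b s))) \<in> measurable (phase_algebra a b) (phase_algebra a b)"
    using f g unfolding phase_algebra_def
    by (intro measurable_Pair measurable_restrict_space2) (auto simp: Pi_iff)
  then show ?thesis by simp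
qed

lemma bounce_length_measurable:
  "(\<lambda>s. dist (bounce_point a b s k) (bounce_point a b s (k + 1))) \<in> borel_measurable (phase_algebra a b)"
proof -
  have "(\<lambda>s. flight_time a b ((bounce a b ^^ k) s)) \<in> borel_measurable (phase_algebra a b)"
    by (rule measurable_compose[OF measurable_compose_n[OF bounce_measurable] flight_time_measurable])
  then show ?thesis
    by (rule measurable_cong[THEN iffD2, rotated]) (simp only: space_phase_algebra dist_bounce_point)
qed

lemma measurable_circle_param:
  assumes "sets M = sets (borel :: real measure)"
  shows "(\<lambda>\<theta>. (cos \<theta>, sin \<theta>)) \<in> measurable M (restrict_space borel (sphere 0 1))"
  unfolding measurable_cong_sets[OF assms refl]
proof (rule measurable_restrict_space2)
  show "(\<lambda>\<theta>. (cos \<theta>, sin \<theta>)) \<in> borel_measurable (borel :: real measure)"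
    by (intro borel_measurable_continuous_onI continuous_intros)
qed (auto simp: norm_Pair)

lemma prob_space_uniform_angle: "prob_space (uniform_measure lborel {0..<2 * pi})"
  by (intro prob_space_uniform_measure) auto

lemma prob_space_uniform_circle: "prob_space uniform_circle"
  unfolding uniform_circle_def
  by (intro prob_space.prob_space_distr prob_space_uniform_angle) (simp add: measurable_circle_param)

lemma sets_uniform_circle: "sets uniform_circle = sets (restrict_space borel (sphere 0 1))"
  by (simp add: uniform_circle_def)

text \<open>
  Averages over directions are computed as Henstock-Kurzweil integrals over the angle; this transfers them to
  the uniform law on the circle.
\<close>
lemma integral_uniform_circle:
  assumes g: "g \<in> borel_measurable uniform_circle" and bound: "\<And>v. \<bar>g v\<bar> \<le> (B::real)"
    and I: "((\<lambda>\<theta>. g (cos \<theta>, sin \<theta>)) has_integral I) {0..2 * pi}"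
  shows "(\<integral>v. g v \<partial>uniform_circle) = I / (2 * pi)"
proof -
  let ?U = "uniform_measure lborel {0..<2 * pi}"
  define f where "f \<theta> = g (cos \<theta>, sin \<theta>)" for \<theta>
  interpret U: prob_space ?U by (rule prob_space_uniform_angle)
  have g': "g \<in> borel_measurable (restrict_space borel (sphere 0 1))"
    using g unfolding measurable_cong_sets[OF sets_uniform_circle refl] .
  have f: "f \<in> borel_measurable borel" unfolding f_def
    by (rule measurable_compose[OF measurable_circle_param[OF refl] g'])
  have dens: "?U = density lborel (\<lambda>\<theta>. ennreal (indicator {0..<2 * pi} \<theta> / (2 * pi)))"
    unfolding uniform_measure_def
    by (intro arg_cong2[where f = density] ext refl) (auto simp: indicator_def ennreal_1[symmetric] divide_ennreal simp del: ennreal_1)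
  have int: "integrable ?U f"
    using f bound by (intro U.integrable_const_bound[where B = B]) (auto simp: f_def)
  have "(\<integral>v. g v \<partial>uniform_circle) = (\<integral>\<theta>. f \<theta> \<partial>?U)"
    unfolding uniform_circle_def f_def by (intro integral_distr g' measurable_circle_param) simp
  also have "\<dots> = (\<integral>\<theta>. (indicator {0..<2 * pi} \<theta> / (2 * pi)) *\<^sub>R f \<theta> \<partial>lborel)"
    unfolding dens using f by (intro integral_density) auto
  also have "\<dots> = I / (2 * pi)"
  proof (rule has_integral_unique)
    have "integrable lborel (\<lambda>\<theta>. (indicator {0..<2 * pi} \<theta> / (2 * pi)) *\<^sub>R f \<theta>)"
      using int unfolding dens by (subst (asm) integrable_density) (use f in auto)
    then show "((\<lambda>\<theta>. (indicator {0..<2 * pi} \<theta> / (2 * pi)) *\<^sub>R f \<theta>) has_integral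
        (\<integral>\<theta>. (indicator {0..<2 * pi} \<theta> / (2 * pi)) *\<^sub>R f \<theta> \<partial>lborel)) UNIV"
      by (rule has_integral_integral_lborel)
    have "((\<lambda>\<theta>. f \<theta> / (2 * pi)) has_integral I / (2 * pi)) {0..2 * pi}"
      using I unfolding f_def by (rule has_integral_divide)
    then have "((\<lambda>\<theta>. if \<theta> \<in> {0..2 * pi} then f \<theta> / (2 * pi) else 0) has_integral I / (2 * pi)) UNIV"
      by (simp only: has_integral_restrict_UNIV)
    then show "((\<lambda>\<theta>. (indicator {0..<2 * pi} \<theta> / (2 * pi)) *\<^sub>R f \<theta>) has_integral I / (2 * pi)) UNIV"
      by (rule has_integral_spike_finite[rotated 2, where S = "{2 * pi}"]) (auto simp: indicator_def)
  qed
  finally show ?thesis .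
qed

lemma AE_uniform_circle_ne: "AE v in uniform_circle. v \<noteq> u"
proof -
  have "AE \<theta> in uniform_measure lborel {0..<2 * pi}. (cos \<theta>, sin \<theta>) \<noteq> u"
  proof (rule AE_uniform_measureI)
    show "AE \<theta> in lborel. \<theta> \<in> {0..<2 * pi} \<longrightarrow> (cos \<theta>, sin \<theta>) \<noteq> u"
    proof (cases "\<exists>\<theta>\<in>{0..<2 * pi}. (cos \<theta>, sin \<theta>) = u")
      case True
      then obtain \<theta>0 where 0: "\<theta>0 \<in> {0..<2 * pi}" "(cos \<theta>0, sin \<theta>0) = u" by blast
      show ?thesis
        using AE_lborel_singleton[of \<theta>0]
      proof eventually_elim
        case (elim \<theta>)
        have "\<theta> = \<theta>0" if "\<theta> \<in> {0..<2 * pi}" "(cos \<theta>, sin \<theta>) = u"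
        proof -
          have sc: "cos \<theta> = cos \<theta>0" "sin \<theta> = sin \<theta>0" using that 0 by auto
          then obtain n :: int where n: "\<theta> = \<theta>0 + 2 * pi * n" using sin_cos_eq_iff[of \<theta> \<theta>0] by auto
          have "\<bar>2 * pi * n\<bar> < 2 * pi" using n that 0 by auto
          then have "\<bar>real_of_int n\<bar> < 1" by (simp add: abs_mult)
          then show ?thesis using n by simp
        qed
        then show ?case using elim by blast
      qed
    next
      case False
      then show ?thesis by auto
    qed
  qed simp
  moreover have "{v \<in> space (restrict_space borel (sphere 0 (1::real))). v \<noteq> u} \<in> sets (restrict_space borel (sphere 0 1))"
  proof -
    have "{v \<in> space (restrict_space borel (sphere 0 (1::real))). v \<noteq> u} = sphere 0 1 - {u}"
      by (auto simp: space_restrict_space)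
    moreover have "sphere 0 1 - {u} \<in> sets borel" by (intro sets.Diff borel_closed closed_sphere) auto
    ultimately show ?thesis by (simp add: sets_restrict_space_iff)
  qed
  ultimately show ?thesis unfolding uniform_circle_def
    by (subst AE_distr_iff) (auto simp: measurable_circle_param)
qed

text \<open>
  A rational ratio of the periods prescribes \<open>\<bar>v\<bar> / \<bar>w\<bar>\<close>, which leaves at most four unit vectors.
\<close>
lemma countable_rational_directions:
  fixes a b :: real
  assumes "0 < a" "0 < b"
  shows "countable {v \<in> sphere 0 1. fst v = 0 \<or> snd v = 0 \<or> (b / \<bar>snd v\<bar>) / (a / \<bar>fst v\<bar>) \<in> \<rat>}"
proof -
  define D where "D r = {v :: real \<times> real. norm v = 1 \<and> \<bar>fst v\<bar> = r * \<bar>snd v\<bar>}" for r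
  have "finite (D r)" for r
  proof -
    define c where "c = 1 / sqrt (1 + r\<^sup>2)"
    have "D r \<subseteq> {- \<bar>r\<bar> * c, \<bar>r\<bar> * c} \<times> {- c, c}"
    proof
      fix v assume "v \<in> D r"
      then have n: "(fst v)\<^sup>2 + (snd v)\<^sup>2 = 1" and e: "\<bar>fst v\<bar> = r * \<bar>snd v\<bar>"
        by (cases v; simp add: D_def norm_Pair)+
      have "(fst v)\<^sup>2 = r\<^sup>2 * (snd v)\<^sup>2" using arg_cong[OF e, of "\<lambda>x. x\<^sup>2"] by (simp add: power_mult_distrib)
      then have "(1 + r\<^sup>2) * (snd v)\<^sup>2 = 1" using n by (simp add: algebra_simps)
      moreover have pos: "0 < 1 + r\<^sup>2" by (simp add: add_pos_nonneg)
      ultimately have "(snd v)\<^sup>2 = c\<^sup>2" by (simp add: c_def power_divide field_simps)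
      then have s: "\<bar>snd v\<bar> = c" using pos by (simp add: power2_eq_iff c_def abs_if)  (smt (verit) power2_eq_iff divide_nonneg_nonneg real_sqrt_ge_zero)
      moreover have "\<bar>fst v\<bar> = \<bar>r\<bar> * c" using arg_cong[OF e, of abs] s by (simp add: abs_mult)
      ultimately show "v \<in> {- \<bar>r\<bar> * c, \<bar>r\<bar> * c} \<times> {- c, c}"
        by (cases v) (auto simp: abs_if split: if_splits)
    qed
    then show ?thesis by (rule finite_subset) auto
  qed
  then have "countable ({(1, 0), (-1, 0)} \<union> (\<Union>q\<in>\<rat>. D (q * a / b)))"
    by (intro countable_Un countable_UN countable_rat) (auto intro: countable_finite)
  moreover have "{v \<in> sphere 0 1. fst v = 0 \<or> snd v = 0 \<or> (b / \<bar>snd v\<bar>) / (a / \<bar>fst v\<bar>) \<in> \<rat>}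
      \<subseteq> {(1, 0), (-1, 0)} \<union> (\<Union>q\<in>\<rat>. D (q * a / b))"
  proof
    fix u assume u: "u \<in> {v \<in> sphere 0 1. fst v = 0 \<or> snd v = 0 \<or> (b / \<bar>snd v\<bar>) / (a / \<bar>fst v\<bar>) \<in> \<rat>}"
    then have n: "norm u = 1" by simp
    consider "fst u = 0" | "snd u = 0" | "fst u \<noteq> 0" "snd u \<noteq> 0" "(b / \<bar>snd u\<bar>) / (a / \<bar>fst u\<bar>) \<in> \<rat>"
      using u by blast
    then show "u \<in> {(1, 0), (-1, 0)} \<union> (\<Union>q\<in>\<rat>. D (q * a / b))"
    proof cases
      case 1
      then have "u \<in> D (0 * a / b)" using n by (simp add: D_def)
      then show ?thesis using Rats_0 by blast
    next
      case 2
      then show ?thesis using n by (cases u) (auto simp: norm_Pair abs_if split: if_splits)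
    next
      case 3
      then have "u \<in> D ((b / \<bar>snd u\<bar>) / (a / \<bar>fst u\<bar>) * a / b)" using n assms by (simp add: D_def)
      then show ?thesis using 3(3) by blast
    qed
  qed
  ultimately show ?thesis by (rule countable_subset[rotated])
qed

lemma AE_uniform_circle_irrational:
  assumes "0 < a" "0 < b"
  shows "AE v in uniform_circle. v \<in> sphere 0 1 \<and> fst v \<noteq> 0 \<and> snd v \<noteq> 0 \<and> (b / \<bar>snd v\<bar>) / (a / \<bar>fst v\<bar>) \<notin> \<rat>"
proof -
  let ?D = "{v \<in> sphere 0 1. fst v = 0 \<or> snd v = 0 \<or> (b / \<bar>snd v\<bar>) / (a / \<bar>fst v\<bar>) \<in> \<rat>}"
  have "AE v in uniform_circle. \<forall>u\<in>?D. v \<noteq> u"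
    using countable_rational_directions[OF assms] AE_uniform_circle_ne by (subst AE_ball_countable) auto
  moreover have "AE v in uniform_circle. v \<in> sphere 0 1"
    using AE_space[of uniform_circle] by (simp add: uniform_circle_def space_restrict_space)
  ultimately show ?thesis by eventually_elim blast
qed

section \<open>The law of a random bounce length\<close>

lemma size_all_bounce_lengths: "size (all_bounce_lengths a b M N \<omega>) = M * (N - 1)"
  by (simp add: all_bounce_lengths_def bounce_lengths_def size_multiset_sum)

lemma measure_pmf_of_multiset:
  assumes "X \<noteq> {#}"
  shows "measure (measure_pmf (pmf_of_multiset X)) A = size (filter_mset (\<lambda>x. x \<in> A) X) / size X"
proof -
  have "measure (measure_pmf (pmf_of_multiset X)) A = measure (measure_pmf (pmf_of_multiset X)) (A \<inter> set_mset X)"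
    using measure_Int_set_pmf[of "pmf_of_multiset X" A] assms by simp
  also have "\<dots> = (\<Sum>x\<in>A \<inter> set_mset X. count X x / size X)"
    using assms by (subst measure_measure_pmf_finite) auto
  also have "\<dots> = (\<Sum>x\<in>A \<inter> set_mset X. count X x) / size X"
    by (simp add: sum_divide_distrib)
  also have "(\<Sum>x\<in>A \<inter> set_mset X. count X x) = size (filter_mset (\<lambda>x. x \<in> A) X)"
    unfolding size_multiset_overloaded_eq by (intro sum.cong) auto
  finally show ?thesis .
qed

lemma size_filter_image_mset:
  assumes "finite K"
  shows "size (filter_mset P {#f k. k \<in># mset_set K#}) = (\<Sum>k\<in>K. of_bool (P (f k)))"
  using assms by (induction K rule: finite_induct) auto

lemma size_filter_sum:
  "size (filter_mset P (\<Sum>i<M. X i)) = (\<Sum>i<M. size (filter_mset P (X i)))" for M :: nat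
  by (induction M) auto

definition bounce_frequency where
  "bounce_frequency a b N A s =
     (\<Sum>k\<in>{1..<N}. indicator A (dist (bounce_point a b s k) (bounce_point a b s (k + 1)))) / real (N - 1)"

lemma bounce_frequency_bounds: "0 \<le> bounce_frequency a b N A s" "bounce_frequency a b N A s \<le> 1"
proof -
  show "0 \<le> bounce_frequency a b N A s" by (auto simp: bounce_frequency_def intro!: divide_nonneg_nonneg sum_nonneg)
  have "(\<Sum>k\<in>{1..<N}. indicator A (dist (bounce_point a b s k) (bounce_point a b s (k + 1)))) \<le> (\<Sum>k\<in>{1..<N}. 1 :: real)"
    by (intro sum_mono) (simp add: indicator_def)
  also have "\<dots> = real (N - 1)" by simp
  finally show "bounce_frequency a b N A s \<le> 1" unfolding bounce_frequency_def by (cases "N - 1 = 0") auto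
qed

lemma bounce_frequency_measurable:
  assumes "A \<in> sets borel"
  shows "bounce_frequency a b N A \<in> borel_measurable (phase_algebra a b)"
proof -
  have "(\<lambda>s. indicator A (dist (bounce_point a b s k) (bounce_point a b s (k + 1))) :: real) \<in> borel_measurable (phase_algebra a b)" for k
    using assms by (intro measurable_compose[OF bounce_length_measurable] borel_measurable_indicator)
  then show ?thesis unfolding bounce_frequency_def[abs_def]
    by (intro borel_measurable_divide borel_measurable_sum) auto
qed

abbreviation sample_kernel where
  "sample_kernel a b M N \<omega> \<equiv> distr (measure_pmf (pmf_of_multiset (all_bounce_lengths a b M N \<omega>))) borel (\<lambda>x. x)"

lemma prob_space_sample_kernel: "prob_space (sample_kernel a b M N \<omega>)"
  by (intro prob_space.prob_space_distr measure_pmf.prob_space_axioms) simp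

text \<open>
  All particles contribute the same number \<open>N - 1\<close> of bounce lengths, so the empirical measure of
  the whole multiset is the plain average of the empirical measures of the particles.
\<close>
lemma emeasure_sample_kernel:
  assumes "1 \<le> M" "2 \<le> N" "A \<in> sets borel"
  shows "emeasure (sample_kernel a b M N \<omega>) A = ennreal ((\<Sum>i<M. bounce_frequency a b N A (\<omega> i)) / M)"
proof -
  let ?X = "all_bounce_lengths a b M N \<omega>"
  have ne: "?X \<noteq> {#}" using size_all_bounce_lengths[of a b M N \<omega>] assms by (auto simp: size_eq_0_iff_empty[symmetric] simp del: size_eq_0_iff_empty)
  have "emeasure (sample_kernel a b M N \<omega>) A = ennreal (size (filter_mset (\<lambda>x. x \<in> A) ?X) / size ?X)"
    using assms(3) by (simp add: emeasure_distr measure_pmf.emeasure_eq_measure measure_pmf_of_multiset[OF ne])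
  also have "size (filter_mset (\<lambda>x. x \<in> A) ?X) = (\<Sum>i<M. \<Sum>k\<in>{1..<N}. of_bool (dist (bounce_point a b (\<omega> i) k) (bounce_point a b (\<omega> i) (k + 1)) \<in> A))"
    unfolding all_bounce_lengths_def bounce_lengths_def size_filter_sum by (simp add: size_filter_image_mset)
  also have "real \<dots> / size ?X = (\<Sum>i<M. bounce_frequency a b N A (\<omega> i)) / M"
    unfolding size_all_bounce_lengths bounce_frequency_def
    by (simp add: sum_divide_distrib[symmetric] indicator_def mult.commute)
  finally show ?thesis .
qed

locale particle_gas =
  fixes a b :: real and \<mu> :: "(real \<times> real) measure"
  assumes sides: "0 < a" "0 < b"
    and prob: "prob_space \<mu>"
    and sets_\<mu>: "sets \<mu> = sets (restrict_space borel (rectangle a b))"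
begin

abbreviation particle_law where "particle_law \<equiv> \<mu> \<Otimes>\<^sub>M uniform_circle"

lemma sets_particle_law: "sets particle_law = sets (phase_algebra a b)"
  unfolding phase_algebra_def by (intro sets_pair_measure_cong sets_\<mu> sets_uniform_circle)

lemma measurable_particle_law: "measurable particle_law N = measurable (phase_algebra a b) N"
  by (rule measurable_cong_sets[OF sets_particle_law refl])

lemma space_particle_law: "space particle_law = phase_space a b"
  using sets_eq_imp_space_eq[OF sets_particle_law] by (simp add: space_phase_algebra)

lemma prob_particle_law: "prob_space particle_law"
  by (intro prob_space_pair prob prob_space_uniform_circle)

lemma prob_particles_law: "prob_space (particles_law \<mu> M)"
  unfolding particles_law_def by (intro prob_space_PiM prob_particle_law)

lemma distr_snd: "distr particle_law uniform_circle snd = uniform_circle"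
proof (rule measure_eqI)
  interpret mu: prob_space \<mu> by (rule prob)
  interpret U: prob_space uniform_circle by (rule prob_space_uniform_circle)
  fix A assume "A \<in> sets (distr particle_law uniform_circle snd)"
  then have A: "A \<in> sets uniform_circle" by simp
  then have "snd -` A \<inter> space particle_law = space \<mu> \<times> A"
    using sets.sets_into_space by (fastforce simp: space_pair_measure)
  then show "emeasure (distr particle_law uniform_circle snd) A = emeasure uniform_circle A"
    using A by (simp add: emeasure_distr U.emeasure_pair_measure_Times mu.emeasure_space_1)
qed simp

lemma sample_kernel_measurable:
  assumes "1 \<le> M" "2 \<le> N"
  shows "sample_kernel a b M N \<in> measurable (particles_law \<mu> M) (subprob_algebra borel)"
proof (rule measurable_subprob_algebra)
  fix A :: "real set" assume A: "A \<in> sets borel"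
  have "(\<lambda>\<omega>. bounce_frequency a b N A (\<omega> i)) \<in> borel_measurable (particles_law \<mu> M)" if "i < M" for i
    unfolding particles_law_def
    by (rule measurable_compose[OF measurable_component_singleton])
       (use that bounce_frequency_measurable[OF A] in \<open>auto simp: measurable_particle_law\<close>)
  then show "(\<lambda>\<omega>. emeasure (sample_kernel a b M N \<omega>) A) \<in> borel_measurable (particles_law \<mu> M)"
    unfolding emeasure_sample_kernel[OF assms A]
    by (intro measurable_compose[OF _ measurable_ennreal] borel_measurable_divide borel_measurable_sum) auto
qed (auto intro: prob_space_imp_subprob_space prob_space_sample_kernel)

lemma real_distribution_bounce_length_law:
  assumes "1 \<le> M" "2 \<le> N"
  shows "real_distribution (bounce_length_law a b \<mu> M N)"
proof -
  interpret prob_space "particles_law \<mu> M" by (rule prob_particles_law)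
  have "prob_space (bounce_length_law a b \<mu> M N)"
    unfolding bounce_length_law_def using prob_space_sample_kernel
    by (intro prob_space_bind[OF _ sample_kernel_measurable[OF assms]]) auto
  moreover have "sets (bounce_length_law a b \<mu> M N) = sets borel"
    unfolding bounce_length_law_def by (rule sets_bind) (auto simp: not_empty)
  ultimately show ?thesis by (intro real_distribution.intro real_distribution_axioms.intro)
qed

lemma integrable_bounce_frequency:
  "A \<in> sets borel \<Longrightarrow> integrable particle_law (bounce_frequency a b N A)"
  by (intro finite_measure.integrable_const_bound[where B = 1] prob_space.finite_measure prob_particle_law)
     (auto simp: measurable_particle_law bounce_frequency_measurable bounce_frequency_bounds)

text \<open>
  By linearity of the expectation, the law of the sampled bounce length does not depend on the
  number of particles.
\<close>
lemma emeasure_bounce_length_law: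
  assumes "1 \<le> M" "2 \<le> N" "A \<in> sets borel"
  shows "emeasure (bounce_length_law a b \<mu> M N) A = ennreal (\<integral>s. bounce_frequency a b N A s \<partial>particle_law)"
proof -
  interpret prob_space "particles_law \<mu> M" by (rule prob_particles_law)
  have comp: "distr (particles_law \<mu> M) particle_law (\<lambda>\<omega>. \<omega> i) = particle_law" if "i < M" for i
    unfolding particles_law_def using that prob_particle_law by (subst distr_PiM_component) auto
  have meas: "(\<lambda>\<omega>. \<omega> i) \<in> measurable (particles_law \<mu> M) particle_law" if "i < M" for i
    unfolding particles_law_def using that by (intro measurable_component_singleton) auto
  have freq: "bounce_frequency a b N A \<in> borel_measurable particle_law"
    by (simp add: measurable_particle_law bounce_frequency_measurable[OF assms(3)])
  have int: "integrable (particles_law \<mu> M) (\<lambda>\<omega>. bounce_frequency a b N A (\<omega> i))" if "i < M" for i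
    using integrable_distr[OF meas[OF that], of "bounce_frequency a b N A"]
      integrable_bounce_frequency[OF assms(3)] unfolding comp[OF that] by simp
  have "emeasure (bounce_length_law a b \<mu> M N) A =
      (\<integral>\<^sup>+\<omega>. ennreal ((\<Sum>i<M. bounce_frequency a b N A (\<omega> i)) / M) \<partial>particles_law \<mu> M)"
    unfolding bounce_length_law_def emeasure_sample_kernel[OF assms, symmetric]
    by (rule emeasure_bind[OF not_empty sample_kernel_measurable[OF assms(1,2)] assms(3)])
  also have "\<dots> = ennreal (\<integral>\<omega>. (\<Sum>i<M. bounce_frequency a b N A (\<omega> i)) / M \<partial>particles_law \<mu> M)"
    by (intro nn_integral_eq_integral integrable_divide Bochner_Integration.integrable_sum int)
       (auto intro!: AE_I2 divide_nonneg_nonneg sum_nonneg bounce_frequency_bounds)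
  also have "(\<integral>\<omega>. (\<Sum>i<M. bounce_frequency a b N A (\<omega> i)) / M \<partial>particles_law \<mu> M) =
      (\<Sum>i<M. \<integral>\<omega>. bounce_frequency a b N A (\<omega> i) \<partial>particles_law \<mu> M) / M"
    using int by (simp add: Bochner_Integration.integral_sum)
  also have "(\<Sum>i<M. \<integral>\<omega>. bounce_frequency a b N A (\<omega> i) \<partial>particles_law \<mu> M) = (\<Sum>i<M. \<integral>s. bounce_frequency a b N A s \<partial>particle_law)"
    using integral_distr[OF meas freq] comp by (intro sum.cong refl) simp
  finally show ?thesis using assms(1) by simp
qed

lemma bounce_length_law_eq:
  assumes "1 \<le> M" "2 \<le> N"
  shows "bounce_length_law a b \<mu> M N = bounce_length_law a b \<mu> 1 N"
proof (rule measure_eqI)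
  have s: "sets (bounce_length_law a b \<mu> M N) = sets borel" if "1 \<le> M" for M
    using real_distribution_bounce_length_law[OF that assms(2)]
    by (simp add: real_distribution_def real_distribution_axioms_def)
  show "sets (bounce_length_law a b \<mu> M N) = sets (bounce_length_law a b \<mu> 1 N)" using s assms by simp
  fix A assume "A \<in> sets (bounce_length_law a b \<mu> M N)"
  then show "emeasure (bounce_length_law a b \<mu> M N) A = emeasure (bounce_length_law a b \<mu> 1 N) A"
    using s assms by (simp add: emeasure_bounce_length_law)
qed

lemma cdf_bounce_length_law:
  assumes "1 \<le> M" "2 \<le> N"
  shows "cdf (bounce_length_law a b \<mu> M N) x = (\<integral>s. bounce_frequency a b N {..x} s \<partial>particle_law)"
  unfolding cdf_def measure_def using assms
  by (simp add: emeasure_bounce_length_law bounce_frequency_bounds integral_nonneg_AE)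

lemma gap_cdf_direction_measurable:
  "(\<lambda>v. gap_cdf (a / \<bar>fst v\<bar>) (b / \<bar>snd v\<bar>) x) \<in> borel_measurable uniform_circle"
proof -
  have [measurable]: "fst \<in> borel_measurable (borel :: (real \<times> real) measure)" "snd \<in> borel_measurable (borel :: (real \<times> real) measure)"
    by (auto intro!: borel_measurable_continuous_onI continuous_intros)
  have "(\<lambda>v. gap_cdf (a / \<bar>fst v\<bar>) (b / \<bar>snd v\<bar>) x) \<in> borel_measurable (borel :: (real \<times> real) measure)"
    unfolding gap_cdf_def by measurable
  then show ?thesis unfolding measurable_cong_sets[OF sets_uniform_circle refl]
    by (rule measurable_restrict_space1)
qed

lemma gap_cdf_bounds: "0 \<le> \<alpha> \<Longrightarrow> 0 \<le> \<beta> \<Longrightarrow> \<bar>gap_cdf \<alpha> \<beta> x\<bar> \<le> 1"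
  by (auto simp: gap_cdf_def divide_le_eq)

lemma integral_gap_cdf:
  "(\<integral>s. gap_cdf (a / \<bar>fst (snd s)\<bar>) (b / \<bar>snd (snd s)\<bar>) x \<partial>particle_law) = bounce_cdf a b x"
proof -
  have "(\<integral>v. gap_cdf (a / \<bar>fst v\<bar>) (b / \<bar>snd v\<bar>) x \<partial>uniform_circle) = 2 * pi * bounce_cdf a b x / (2 * pi)"
    using has_integral_gap_cdf_circle[OF sides, of x] sides
    by (intro integral_uniform_circle[OF gap_cdf_direction_measurable, where B = 1] gap_cdf_bounds) auto
  then show ?thesis
    using integral_distr[OF measurable_snd gap_cdf_direction_measurable, of \<mu> x] distr_snd by simp
qed

text \<open>
  For almost every initial state the ratio of periods is irrational and the empirical frequencies
  converge; they are bounded by 1, so their expectations converge as well.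
\<close>
lemma cdf_tendsto:
  "(\<lambda>N. cdf (bounce_length_law a b \<mu> 1 N) x) \<longlonglongrightarrow> bounce_cdf a b x"
proof -
  have "(\<lambda>N. \<integral>s. bounce_frequency a b N {..x} s \<partial>particle_law) \<longlonglongrightarrow>
      (\<integral>s. gap_cdf (a / \<bar>fst (snd s)\<bar>) (b / \<bar>snd (snd s)\<bar>) x \<partial>particle_law)"
  proof (rule integral_dominated_convergence[where w = "\<lambda>_. 1"])
    show "(\<lambda>s. gap_cdf (a / \<bar>fst (snd s)\<bar>) (b / \<bar>snd (snd s)\<bar>) x) \<in> borel_measurable particle_law"
      by (rule measurable_compose[OF measurable_snd gap_cdf_direction_measurable])
    show "integrable particle_law (\<lambda>_. 1 :: real)"
      using prob_particle_law by (intro finite_measure.integrable_const prob_space.finite_measure)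
    have "AE v in distr particle_law uniform_circle snd. v \<in> sphere 0 1 \<and> fst v \<noteq> 0 \<and> snd v \<noteq> 0 \<and> (b / \<bar>snd v\<bar>) / (a / \<bar>fst v\<bar>) \<notin> \<rat>"
      unfolding distr_snd by (rule AE_uniform_circle_irrational[OF sides])
    then have "AE s in particle_law. snd s \<in> sphere 0 1 \<and> fst (snd s) \<noteq> 0 \<and> snd (snd s) \<noteq> 0 \<and> (b / \<bar>snd (snd s)\<bar>) / (a / \<bar>fst (snd s)\<bar>) \<notin> \<rat>"
      by (rule AE_distrD[OF measurable_snd])
    moreover have "AE s in particle_law. s \<in> phase_space a b"
      using AE_space[of particle_law] by (simp only: space_particle_law)
    ultimately show "AE s in particle_law. (\<lambda>N. bounce_frequency a b N {..x} s) \<longlonglongrightarrow> gap_cdf (a / \<bar>fst (snd s)\<bar>) (b / \<bar>snd (snd s)\<bar>) x"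
    proof eventually_elim
      case (elim s)
      then show ?case
        unfolding bounce_frequency_def using sides by (intro bounce_length_frequency) auto
    qed
  qed (auto simp: measurable_particle_law bounce_frequency_measurable bounce_frequency_bounds)
  then have "(\<lambda>N. \<integral>s. bounce_frequency a b N {..x} s \<partial>particle_law) \<longlonglongrightarrow> bounce_cdf a b x"
    by (simp only: integral_gap_cdf)
  moreover have "\<forall>\<^sub>F N in sequentially. (\<integral>s. bounce_frequency a b N {..x} s \<partial>particle_law) = cdf (bounce_length_law a b \<mu> 1 N) x"
    using eventually_ge_at_top[of 2] by eventually_elim (simp add: cdf_bounce_length_law)
  ultimately show ?thesis by (rule Lim_transform_eventually)
qed

end

theorem theorem7:
  fixes a b :: real and \<mu> :: "(real \<times> real) measure"
  assumes "0 < a" and "a \<le> b"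
    and "prob_space \<mu>" and "sets \<mu> = sets (restrict_space borel (rectangle a b))"
  shows "real_distribution (density lborel (\<lambda>t. ennreal (bounce_pdf a b t))) \<and>
    (\<forall>M\<ge>1. \<forall>N\<ge>2. real_distribution (bounce_length_law a b \<mu> M N)) \<and>
    (\<exists>\<nu>. (\<forall>N\<ge>2. real_distribution (\<nu> N) \<and>
             weak_conv_m (\<lambda>M. bounce_length_law a b \<mu> M N) (\<nu> N)) \<and>
         weak_conv_m \<nu> (density lborel (\<lambda>t. ennreal (bounce_pdf a b t))))"
proof -
  interpret particle_gas a b \<mu>
    by (rule particle_gas.intro[OF assms(1) less_le_trans[OF assms(1,2)] assms(3,4)])
  note limit_law = bounce_law_def[of a b, symmetric]
  \<comment> \<open>the limit in the number of particles is the law for a single particle\<close>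
  have "weak_conv_m (\<lambda>M. bounce_length_law a b \<mu> M N) (bounce_length_law a b \<mu> 1 N)" if "2 \<le> N" for N
    unfolding weak_conv_m_def weak_conv_def
  proof (intro allI impI)
    fix x
    have "\<forall>\<^sub>F M in sequentially. cdf (bounce_length_law a b \<mu> M N) x = cdf (bounce_length_law a b \<mu> 1 N) x"
      using eventually_ge_at_top[of 1] by eventually_elim (rule arg_cong[where f = "\<lambda>L. cdf L x", OF bounce_length_law_eq[OF _ that]])
    then show "(\<lambda>M. cdf (bounce_length_law a b \<mu> M N) x) \<longlonglongrightarrow> cdf (bounce_length_law a b \<mu> 1 N) x"
      by (rule tendsto_eventually)
  qed
  moreover have "weak_conv_m (bounce_length_law a b \<mu> 1) (bounce_law a b)"
    unfolding weak_conv_m_def weak_conv_def using cdf_tendsto cdf_bounce_law[OF assms(1,2)] by simp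
  ultimately show ?thesis
    unfolding limit_law
    using real_distribution_bounce_law[OF assms(1,2)] real_distribution_bounce_length_law by blast
qed

end
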